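(* Let $k\ge5$ be odd and consider the regular $k$-gon process. Then for every $x>0$, \[ 0<\liminf_{n\to\infty}\mathbb P\{\sqrt n\,(m_n-\rho_k)>x\}\le\limsup_{n\to\infty}\mathbb P\{\sqrt n\,(m_n-\rho_k)>x\}<1. \]
   Context: Let $k\ge5$ be odd and $K\subset\mathbb R^2$ the regular $k$-gon with circumradius $1$, centroid at the origin, with $(0,1)$ a vertex; $v_1,\dots,v_k$ are the position vectors of its vertices, and $\rho_k=\cos(\pi/k)$. The regular $k$-gon process: $K_0=K$, $p_{n+1}$ uniform random point in $K_n$ (conditionally on $p_1,\dots,p_n$), $K_{n+1}=K_n\cap(p_{n+1}+K)$. The $i$th height of $K_n$ is $m_i(n)=\max_{x\in K_n}\langle x,v_i\rangle-\min_{x\in K_n}\langle x,v_i\rangle$, and $m_n=\max_i m_i(n)$. *)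

theory Defs
  imports "HOL-Analysis.Analysis"
begin

type_synonym pt = "real \<times> real"

definition vtx :: "nat \<Rightarrow> nat \<Rightarrow> pt" where
  "vtx k i = (cos (pi/2 + 2*pi*real i / real k), sin (pi/2 + 2*pi*real i / real k))"

definition kgon :: "nat \<Rightarrow> pt set" where
  "kgon k = convex hull (vtx k ` {..<k})"

definition rho :: "nat \<Rightarrow> real" where
  "rho k = cos (pi / real k)"

definition Kn :: "nat \<Rightarrow> pt list \<Rightarrow> pt set" where
  "Kn k ps = kgon k \<inter> (\<Inter>p\<in>set ps. (\<lambda>y. p + y) ` kgon k)"

definition height :: "nat \<Rightarrow> pt list \<Rightarrow> nat \<Rightarrow> real" where
  "height k ps i = (SUP y\<in>Kn k ps. y \<bullet> vtx k i) - (INF y\<in>Kn k ps. y \<bullet> vtx k i)"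

definition maxheight :: "nat \<Rightarrow> pt list \<Rightarrow> real" where
  "maxheight k ps = Max (height k ps ` {..<k})"

text \<open>Expectation of a functional g of (p_1,...,p_N) for the k-gon process, where
  ps is the list of points already chosen and n further points are chosen,
  each uniformly in the current K.\<close>
fun proc_expect :: "nat \<Rightarrow> nat \<Rightarrow> (pt list \<Rightarrow> real) \<Rightarrow> pt list \<Rightarrow> real" where
  "proc_expect k 0 g ps = g ps"
| "proc_expect k (Suc n) g ps =
     (LINT p : Kn k ps | lborel. proc_expect k n g (ps @ [p])) / measure lborel (Kn k ps)"

definition proc_prob :: "nat \<Rightarrow> nat \<Rightarrow> (pt list \<Rightarrow> bool) \<Rightarrow> real" where
  "proc_prob k n E = proc_expect k n (\<lambda>ps. if E ps then 1 else 0) []"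

end

theory Submission
  imports Defs
begin

text \<open>Write L for the current polygon and h for its largest height minus \<rho>. Two one-step bounds,
  uniform over all reachable L, carry the proof, both at the scale s = x / sqrt n.

  If h > s, the next step brings h below s with probability at most C s^2: a point p that changes L
  makes some edge j of p + K tight, and since p itself and a fixed fraction of the segment from p to
  the apex in direction j survive, p must lie within O(s) of that apex. All outer edge normals
  are of the form -v l, and none of them equals v j (k is odd), so such a strip has area O(s^2), while the area of L stays bounded
  below. Hence P(h > s after n steps) is at least (1 - C s^2)^n, which tends to exp (- C x^2).

  Conversely, for each single direction i, a homothetic copy of L at its apex shows that the i-th
  height drops below \<rho> + s in one step with probability at least s^2 / 4. Spending n div k steps
  on each of the k directions in turn brings all heights below \<rho> + s with probability bounded
  away from 0, because heights never increase.\<close>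

section \<open>Halfplanes and the odd regular polygon\<close>

text \<open>The area bound is where the history of the process matters: an intersection of arbitrary
  translates of the polygon may be thin or empty, so the order in which the points were drawn has to
  be used. Helly's theorem in the plane reduces the question to three edges, and of the three points
  that determine them the one drawn last supplies the room. Helly's theorem serves a second time to
  find the two edges that bound the polygon in direction \<open>v j\<close>. This avoids following
  the combinatorial shape of the polygon, about which nothing is known along the process. The
  exponent 2 comes from the plane, and it matches the scale:
  \<open>n * s\<^sup>2 = x\<^sup>2\<close> stays fixed, so \<open>n\<close> trials with probability
  of order \<open>s\<^sup>2\<close> leave a limit strictly between 0 and 1. The construction for the
  upper bound controls only one height per success, so the directions are treated one after
  another.\<close>

lemma inner_pt: "(p::pt) \<bullet> q = fst p * fst q + snd p * snd q"
  by (simp add: inner_prod_def)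

definition cross :: "pt \<Rightarrow> pt \<Rightarrow> real" where
  "cross p q = fst p * snd q - snd p * fst q"

lemma linear_system_solution:
  fixes u w :: pt and a b :: real
  assumes "cross u w \<noteq> 0"
  defines "y \<equiv> ((a * snd w - b * snd u) / cross u w, (b * fst u - a * fst w) / cross u w)"
  shows "y \<bullet> u = a" "y \<bullet> w = b"
proof -
  have "y \<bullet> u = a * cross u w / cross u w" "y \<bullet> w = b * cross u w / cross u w"
    unfolding y_def inner_pt by (simp_all add: cross_def add_divide_distrib[symmetric] algebra_simps)
  then show "y \<bullet> u = a" "y \<bullet> w = b" using assms(1) by simp_all
qed

lemma vtx_inner: "vtx k i \<bullet> vtx k j = cos (2 * pi * (real i - real j) / real k)"
proof -
  have "vtx k i \<bullet> vtx k j = cos ((pi/2 + 2*pi*real i / real k) - (pi/2 + 2*pi*real j / real k))"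
    unfolding inner_pt vtx_def cos_diff by simp
  also have "\<dots> = cos (2 * pi * (real i - real j) / real k)"
    by (simp add: diff_divide_distrib right_diff_distrib)
  finally show ?thesis .
qed

lemma cross_vtx: "cross (vtx k i) (vtx k j) = sin (2 * pi * (real j - real i) / real k)"
proof -
  have "cross (vtx k i) (vtx k j) = sin ((pi/2 + 2*pi*real j / real k) - (pi/2 + 2*pi*real i / real k))"
    unfolding cross_def vtx_def sin_diff by simp
  also have "\<dots> = sin (2 * pi * (real j - real i) / real k)"
    by (simp add: diff_divide_distrib right_diff_distrib)
  finally show ?thesis .
qed

lemma norm_vtx [simp]: "norm (vtx k i) = 1"
  by (simp add: norm_eq_sqrt_inner vtx_inner)

lemma abs_inner_vtx_le: "\<bar>y \<bullet> vtx k i\<bar> \<le> norm y"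
  using Cauchy_Schwarz_ineq2[of y "vtx k i"] by simp

lemma abs_fst_vtx_le: "\<bar>fst (vtx k i)\<bar> \<le> 1" and abs_snd_vtx_le: "\<bar>snd (vtx k i)\<bar> \<le> 1"
  by (simp_all add: vtx_def)

lemma vtx_mod_eq:
  assumes "k > 0"
  shows "vtx k (nat (c mod int k))
    = (cos (pi/2 + 2*pi*real_of_int c / real k), sin (pi/2 + 2*pi*real_of_int c / real k))"
proof -
  have "real_of_int c = real_of_int (int (nat (c mod int k)) + int k * (c div int k))"
    using assms by simp
  then have "real_of_int c = real (nat (c mod int k)) + real k * real_of_int (c div int k)"
    by (simp only: of_int_add of_int_mult of_int_of_nat_eq)
  then have "pi/2 + 2*pi*real_of_int c / real k
      = (pi/2 + 2*pi*real (nat (c mod int k)) / real k) + 2*pi*real_of_int (c div int k)"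
    using assms by (simp add: field_simps)
  then show ?thesis
    by (simp only: vtx_def) (simp add: cos_add sin_add)
qed

lemma measure_lborel_cbox_pt:
  fixes z :: pt
  assumes "r \<ge> 0"
  shows "measure lborel (cbox (z - (r, r)) (z + (r, r))) = (2 * r)\<^sup>2"
proof -
  have "measure lborel (cbox (z - (r, r)) (z + (r, r))) = (\<Prod>b\<in>Basis. (z + (r, r)) \<bullet> b - (z - (r, r)) \<bullet> b)"
    using assms by (intro content_cbox) (auto simp: Basis_prod_def inner_pt)
  also have "\<dots> = (2 * r)\<^sup>2"
    by (simp add: Basis_prod_def inner_pt power2_eq_square)
  finally show ?thesis .
qed

lemma mem_cbox_pt:
  fixes y z :: pt
  shows "y \<in> cbox (z - (r, r)) (z + (r, r)) \<longleftrightarrow> \<bar>fst (y - z)\<bar> \<le> r \<and> \<bar>snd (y - z)\<bar> \<le> r"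
  by (cases y; cases z) (simp add: cbox_Pair_eq abs_le_iff; linarith)

locale odd_polygon =
  fixes k :: nat
  assumes odd_k: "odd k" and k_ge: "k \<ge> 5"
begin

abbreviation v :: "nat \<Rightarrow> pt" where "v \<equiv> vtx k"

abbreviation \<rho> :: real where "\<rho> \<equiv> rho k"

lemma k_pos: "k > 0" using k_ge by simp

lemma rho_pos: "\<rho> > 0"
  unfolding rho_def using k_ge by (intro cos_gt_zero) (auto simp: field_simps)

lemma rho_le: "\<rho> \<le> 1"
  unfolding rho_def by simp

text \<open>No two vertices are antipodal for odd \<open>k\<close>: the widest angle between two of
  them is pi - pi/k, at index distance (k-1)/2. This puts the vertices into the halfplanes of
  \<open>kgon_eq\<close>.\<close>

lemma vtx_inner_ge:
  assumes "i < k" "j < k"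
  shows "- \<rho> \<le> v i \<bullet> v j"
proof -
  have *: "cos (pi - pi / k) \<le> cos (2 * pi * d / k)" if "0 \<le> d" "2 * d \<le> real (k - 1)" for d :: real
  proof (rule cos_monotone_0_pi_le)
    have "pi * (2 * d) \<le> pi * (real k - 1)"
      using that k_pos by (intro mult_left_mono) (auto simp: of_nat_diff)
    then show "2 * pi * d / k \<le> pi - pi / k"
      using k_pos by (simp add: field_simps)
  qed (use that k_pos in auto)
  define d where "d = \<bar>real i - real j\<bar>"
  have inner: "v i \<bullet> v j = cos (2 * pi * d / k)"
  proof (cases "real i \<ge> real j")
    case True
    then show ?thesis by (simp add: vtx_inner d_def)
  next
    case False
    then have "d = - (real i - real j)" by (simp add: d_def)
    then have "2 * pi * d / k = - (2 * pi * (real i - real j) / k)"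
      by (simp only: mult_minus_right minus_divide_left)
    then show ?thesis by (simp only: vtx_inner cos_minus)
  qed
  define d' where "d' = nat \<bar>int i - int j\<bar>"
  have d': "d = real d'" by (simp add: d_def d'_def)
  have d'k: "d' < k" using assms by (auto simp: d'_def)
  have \<rho>: "- \<rho> = cos (pi - pi / k)" by (simp add: rho_def)
  show ?thesis
  proof (cases "2 * d' \<le> k - 1")
    case True
    then have "2 * d \<le> real (k - 1)" unfolding d' by (metis of_nat_le_iff of_nat_mult of_nat_numeral)
    then show ?thesis using *[of d] inner \<rho> by (simp add: d_def)
  next
    case False
    \<comment> \<open>Only parity excludes \<open>2 * d' = k\<close>, the antipodal case.\<close>
    then have "2 * (k - d') \<le> k - 1" using odd_k d'k by presburger
    then have "2 * (real k - d) \<le> real (k - 1)" unfolding d'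
      using d'k by (metis of_nat_diff less_imp_le of_nat_le_iff of_nat_mult of_nat_numeral)
    then have "cos (pi - pi / k) \<le> cos (2 * pi * (real k - d) / k)"
      using *[of "real k - d"] d'k d' by simp
    also have "2 * pi * (real k - d) / k = 2 * pi - 2 * pi * d / k"
      using k_pos by (simp add: field_simps)
    finally show ?thesis using inner \<rho> by (simp add: cos_diff)
  qed
qed

text \<open>The sine vanishes only if \<open>k\<close> divides 2(j - i), which is impossible for odd
  \<open>k\<close> and distinct indices below \<open>k\<close>. Hence no two edges are parallel, and
  any two values can be prescribed for the functionals \<open>v i\<close> and
  \<open>v j\<close>.\<close>

lemma cross_vtx_nonzero:
  assumes "i < k" "j < k" "i \<noteq> j"
  shows "cross (v i) (v j) \<noteq> 0"
proof
  assume "cross (v i) (v j) = 0"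
  then obtain m :: int where "2 * pi * (real j - real i) / k = of_int m * pi"
    unfolding cross_vtx sin_zero_iff_int2 by blast
  then have "pi * (2 * (real j - real i)) = pi * (of_int m * real k)"
    using k_pos by (simp add: field_simps)
  then have "2 * (real j - real i) = of_int m * real k"
    by (subst (asm) mult_cancel_left) simp
  then have "real_of_int (2 * (int j - int i)) = real_of_int (m * int k)" by simp
  then have "2 * (int j - int i) = m * int k" by (simp only: of_int_eq_iff)
  then have "int k dvd 2 * (int j - int i)" by simp
  moreover have "coprime (int k) 2" using odd_k by simp
  ultimately have "int k dvd int j - int i"
    using coprime_dvd_mult_right_iff by blast
  with assms show False
    using zdvd_imp_le[of "int k" "\<bar>int j - int i\<bar>"] by auto
qed

lemma cross_vtx_lower_bound:
  obtains \<delta> where "\<delta> > 0" "\<And>i j. i < k \<Longrightarrow> j < k \<Longrightarrow> i \<noteq> j \<Longrightarrow> \<delta> \<le> \<bar>cross (v i) (v j)\<bar>"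
proof -
  define A where "A = (\<lambda>(i,j). \<bar>cross (v i) (v j)\<bar>) ` {(i,j). i < k \<and> j < k \<and> i \<noteq> j}"
  have "finite {(i,j). i < k \<and> j < k \<and> i \<noteq> j}"
    by (rule finite_subset[of _ "{..<k} \<times> {..<k}"]) auto
  then have fin: "finite A" unfolding A_def by (rule finite_imageI)
  have "(0::nat, 1::nat) \<in> {(i,j). i < k \<and> j < k \<and> i \<noteq> j}" using k_ge by auto
  then have "A \<noteq> {}" unfolding A_def by blast
  then have "Min A > 0" using fin cross_vtx_nonzero by (auto simp: A_def)
  moreover have "Min A \<le> \<bar>cross (v i) (v j)\<bar>" if "i < k" "j < k" "i \<noteq> j" for i j
    using that by (intro Min_le[OF fin]) (auto simp: A_def)
  ultimately show ?thesis using that by blast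
qed

text \<open>A functional u is a nonnegative combination of the two edge normals adjacent to
  the vertex whose direction is closest to u, and it is maximised there.\<close>
lemma halfplane_point_dominated:
  assumes y: "\<And>l. l < k \<Longrightarrow> - \<rho> \<le> y \<bullet> v l"
  shows "\<exists>c<k. y \<bullet> u \<le> v c \<bullet> u"
proof -
  obtain R \<phi> where R: "R \<ge> 0" and u: "u = (R * cos \<phi>, R * sin \<phi>)"
  proof -
    have "Complex (fst u) (snd u) = cmod (Complex (fst u) (snd u)) * cis (Arg (Complex (fst u) (snd u)))"
      using rcis_cmod_Arg by (metis rcis_def)
    then show thesis
      by (intro that[of "cmod (Complex (fst u) (snd u))" "Arg (Complex (fst u) (snd u))"])
         (auto simp: complex_eq_iff prod_eq_iff)
  qed
  \<comment> \<open>Index of the vertex direction nearest to \<open>\<phi>\<close>, so that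
    \<open>\<psi>\<close> is at most half the angular spacing 2 pi / k. It may fall outside the
    range of indices, hence the reductions mod \<open>k\<close>.\<close>
  define c where "c = round ((\<phi> - pi/2) * k / (2*pi))"
  define \<theta> where "\<theta> = pi/2 + 2*pi*real_of_int c / k"
  define \<psi> where "\<psi> = \<phi> - \<theta>"
  define \<alpha> where "\<alpha> = pi / real k"
  have \<alpha>: "0 < \<alpha>" "\<alpha> < pi/2" using k_ge by (auto simp: \<alpha>_def field_simps)
  have "\<bar>of_int c - (\<phi> - pi/2) * k / (2*pi)\<bar> \<le> 1/2"
    unfolding c_def by (rule of_int_round_abs_le)
  moreover have "of_int c - (\<phi> - pi/2) * k / (2*pi) = - \<psi> * (k / (2 * pi))"
    using k_pos by (simp add: \<psi>_def \<theta>_def field_simps)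
  ultimately have "\<bar>\<psi>\<bar> * (k / (2*pi)) \<le> 1/2"
    by (simp add: abs_mult)
  then have \<psi>: "\<bar>\<psi>\<bar> \<le> \<alpha>" using k_pos by (simp add: \<alpha>_def field_simps)
  \<comment> \<open>The vectors \<open>- v (c - r)\<close> and \<open>- v (c + r)\<close>, indices
    mod \<open>k\<close>, point at the angles \<open>\<theta> + \<alpha>\<close> and
    \<open>\<theta> - \<alpha>\<close>: they are the outer normals of the two edges that meet at
    vertex \<open>c\<close>.\<close>
  define r where "r = (int k - 1) div 2"
  have r: "2 * r = int k - 1" using odd_k by (simp add: r_def)
  then have rr: "2 * real_of_int r = real k - 1" by (metis of_int_1 of_int_diff of_int_mult of_int_numeral of_int_of_nat_eq)
  have *: "v (nat ((c - r) mod int k)) = (- cos (\<theta> + \<alpha>), - sin (\<theta> + \<alpha>))"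
  proof -
    have "pi/2 + 2*pi*real_of_int (c - r) / k = \<theta> - 2 * real_of_int r * pi / k"
      by (simp add: \<theta>_def diff_divide_distrib algebra_simps)
    also have "\<dots> = \<theta> + \<alpha> - pi"
      using k_pos unfolding rr by (simp add: \<alpha>_def diff_divide_distrib left_diff_distrib)
    finally have "pi/2 + 2*pi*real_of_int (c - r) / k = \<theta> + \<alpha> - pi" .
    then show ?thesis by (simp only: vtx_mod_eq[OF k_pos]) simp
  qed
  have **: "v (nat ((c + r) mod int k)) = (- cos (\<theta> - \<alpha>), - sin (\<theta> - \<alpha>))"
  proof -
    have "pi/2 + 2*pi*real_of_int (c + r) / k = \<theta> + 2 * real_of_int r * pi / k"
      by (simp add: \<theta>_def add_divide_distrib algebra_simps)
    also have "\<dots> = \<theta> - \<alpha> + pi"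
      using k_pos unfolding rr by (simp add: \<alpha>_def diff_divide_distrib left_diff_distrib)
    finally have "pi/2 + 2*pi*real_of_int (c + r) / k = \<theta> - \<alpha> + pi" .
    then show ?thesis by (simp only: vtx_mod_eq[OF k_pos]) simp
  qed
  have lt: "nat (z mod int k) < k" for z using k_pos by (simp add: nat_less_iff)
  have vc: "v (nat (c mod int k)) = (cos \<theta>, sin \<theta>)"
    by (simp only: vtx_mod_eq[OF k_pos] \<theta>_def)
  have i1: "y \<bullet> (cos (\<theta> + \<alpha>), sin (\<theta> + \<alpha>)) \<le> cos \<alpha>"
    using y[OF lt[of "c - r"]] unfolding * by (simp add: inner_pt rho_def \<alpha>_def)
  have i2: "y \<bullet> (cos (\<theta> - \<alpha>), sin (\<theta> - \<alpha>)) \<le> cos \<alpha>"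
    using y[OF lt[of "c + r"]] unfolding ** by (simp add: inner_pt rho_def \<alpha>_def)
  have s: "sin (\<alpha> + \<psi>) \<ge> 0" "sin (\<alpha> - \<psi>) \<ge> 0"
    using \<psi> \<alpha> by (auto intro!: sin_ge_zero)
  have s2: "sin (2 * \<alpha>) > 0" using \<alpha> by (intro sin_gt_zero) auto
  have \<phi>: "\<phi> = \<theta> + \<psi>" by (simp add: \<psi>_def)
  have pyth: "sin \<alpha> ^ 2 = 1 - cos \<alpha> ^ 2" by (simp add: sin_squared_eq)
  \<comment> \<open>The unit vector at angle \<open>\<phi>\<close> is decomposed along the two
    normals; the weights are nonnegative since \<open>\<psi>\<close> is at most
    \<open>\<alpha>\<close> in absolute value.\<close>
  have "sin (2*\<alpha>) * (y \<bullet> (cos \<phi>, sin \<phi>))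
      = sin (\<alpha> + \<psi>) * (y \<bullet> (cos (\<theta> + \<alpha>), sin (\<theta> + \<alpha>))) + sin (\<alpha> - \<psi>) * (y \<bullet> (cos (\<theta> - \<alpha>), sin (\<theta> - \<alpha>)))"
    unfolding inner_pt \<phi> cos_add sin_add cos_diff sin_diff sin_double
    using pyth by (simp add: algebra_simps power2_eq_square)
  also have "\<dots> \<le> sin (\<alpha> + \<psi>) * cos \<alpha> + sin (\<alpha> - \<psi>) * cos \<alpha>"
    using i1 i2 s by (intro add_mono mult_left_mono) auto
  also have "\<dots> = sin (2*\<alpha>) * cos \<psi>"
    unfolding sin_add sin_diff sin_double by (simp add: algebra_simps)
  finally have "y \<bullet> (cos \<phi>, sin \<phi>) \<le> cos \<psi>" using s2 by simp
  then have "R * (y \<bullet> (cos \<phi>, sin \<phi>)) \<le> R * cos \<psi>" using R by (rule mult_left_mono)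
  moreover have "R * cos \<psi> = v (nat (c mod int k)) \<bullet> u"
    unfolding vc u inner_pt \<psi>_def cos_diff by (simp add: algebra_simps)
  moreover have "R * (y \<bullet> (cos \<phi>, sin \<phi>)) = y \<bullet> u"
    unfolding u inner_pt by (simp add: algebra_simps)
  ultimately show ?thesis using lt by metis
qed

text \<open>Passes from vertices to halfplanes; the edge opposite vertex \<open>l\<close> has
  \<open>v l\<close> itself as inner normal. A point of all halfplanes outside the hull could be
  strictly separated from it, whereas every functional is dominated at a vertex.\<close>

lemma kgon_eq: "kgon k = {y. \<forall>l<k. - \<rho> \<le> y \<bullet> v l}"
proof (intro antisym subsetI)
  fix y assume y: "y \<in> kgon k"
  have "convex {y. \<forall>l<k. - \<rho> \<le> y \<bullet> v l}"
  proof -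
    have "{y. \<forall>l<k. - \<rho> \<le> y \<bullet> v l} = (\<Inter>l\<in>{..<k}. {y. v l \<bullet> y \<ge> - \<rho>})"
      by (auto simp: inner_commute)
    then show ?thesis by (simp add: convex_INT convex_halfspace_ge)
  qed
  then have "kgon k \<subseteq> {y. \<forall>l<k. - \<rho> \<le> y \<bullet> v l}"
    unfolding kgon_def by (intro hull_minimal) (auto intro: vtx_inner_ge)
  then show "y \<in> {y. \<forall>l<k. - \<rho> \<le> y \<bullet> v l}" using y by auto
next
  fix y assume y: "y \<in> {y. \<forall>l<k. - \<rho> \<le> y \<bullet> v l}"
  show "y \<in> kgon k"
  proof (rule ccontr)
    assume "y \<notin> kgon k"
    moreover have "closed (kgon k)" "convex (kgon k)"
      unfolding kgon_def by (auto intro!: compact_imp_closed finite_imp_compact_convex_hull)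
    ultimately obtain u b where ub: "u \<bullet> y < b" "\<forall>z\<in>kgon k. b < u \<bullet> z"
      using separating_hyperplane_closed_point by metis
    obtain c where c: "c < k" "y \<bullet> (- u) \<le> v c \<bullet> (- u)"
      using halfplane_point_dominated y by blast
    have "v c \<in> kgon k"
      unfolding kgon_def using \<open>c < k\<close> by (auto intro: hull_inc)
    with ub(2) have "b < u \<bullet> v c" by blast
    with ub(1) c(2) show False by (simp add: inner_commute)
  qed
qed

section \<open>Areas of the polygons of the process\<close>

lemma helly_halfplanes:
  assumes "\<And>l m n. l < k \<Longrightarrow> m < k \<Longrightarrow> n < k \<Longrightarrow> l \<noteq> m \<Longrightarrow> l \<noteq> n \<Longrightarrow> m \<noteq> n \<Longrightarrow>
    \<exists>y. b l \<le> y \<bullet> v l \<and> b m \<le> y \<bullet> v m \<and> b n \<le> y \<bullet> v n"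
  shows "\<exists>y. \<forall>l<k. b l \<le> y \<bullet> v l"
proof -
  define H where "H = (\<lambda>l. {y. b l \<le> y \<bullet> v l})"
  \<comment> \<open>\<open>Helly\<close> counts sets, not indices: injectivity turns a subfamily of
    three sets into three distinct indices.\<close>
  have inj: "inj_on H {..<k}"
  proof (rule inj_onI, rule ccontr)
    fix l m assume lm: "l \<in> {..<k}" "m \<in> {..<k}" "H l = H m" "l \<noteq> m"
    obtain y where "y \<bullet> v l = b l" "y \<bullet> v m = b m - 1"
      using linear_system_solution cross_vtx_nonzero[of l m] lm by blast
    then have "y \<in> H l" "y \<notin> H m" by (auto simp: H_def)
    with lm show False by blast
  qed
  have "\<Inter>(H ` {..<k}) \<noteq> {}"
  proof (rule Helly)
    show "DIM(pt) + 1 \<le> card (H ` {..<k})"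
      using inj k_ge by (simp add: card_image)
    show "\<forall>S\<in>H ` {..<k}. convex S"
      by (auto simp: H_def inner_commute[of _ "v _"] convex_halfspace_ge)
    fix t assume t: "t \<subseteq> H ` {..<k}" "card t = DIM(pt) + 1"
    then obtain I where I: "I \<subseteq> {..<k}" "t = H ` I" by (meson subset_imageE)
    then have "card I = 3"
      using t card_image[OF inj_on_subset[OF inj I(1)]] by simp
    then obtain l m n where "I = {l, m, n}" "l \<noteq> m" "l \<noteq> n" "m \<noteq> n"
      by (auto simp: card_3_iff)
    then show "\<Inter>t \<noteq> {}"
      using assms[of l m n] I by (auto simp: H_def)
  qed
  then show ?thesis by (auto simp: H_def)
qed

text \<open>A quantitative form of the absence of parallel edges, fixed once so that all later
  constants can refer to it.\<close>

definition \<delta> :: real where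
  "\<delta> = (SOME \<delta>. \<delta> > 0 \<and> (\<forall>i<k. \<forall>j<k. i \<noteq> j \<longrightarrow> \<delta> \<le> \<bar>cross (v i) (v j)\<bar>))"

lemma \<delta>_pos: "\<delta> > 0" and \<delta>_le: "i < k \<Longrightarrow> j < k \<Longrightarrow> i \<noteq> j \<Longrightarrow> \<delta> \<le> \<bar>cross (v i) (v j)\<bar>"
proof -
  have "\<exists>\<delta>>0. \<forall>i<k. \<forall>j<k. i \<noteq> j \<longrightarrow> \<delta> \<le> \<bar>cross (v i) (v j)\<bar>"
    using cross_vtx_lower_bound by metis
  then have "\<delta> > 0 \<and> (\<forall>i<k. \<forall>j<k. i \<noteq> j \<longrightarrow> \<delta> \<le> \<bar>cross (v i) (v j)\<bar>)"
    unfolding \<delta>_def by (rule someI_ex)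
  then show "\<delta> > 0" "i < k \<Longrightarrow> j < k \<Longrightarrow> i \<noteq> j \<Longrightarrow> \<delta> \<le> \<bar>cross (v i) (v j)\<bar>" by auto
qed

lemma abs_cross_le: "\<bar>cross (v i) (v j)\<bar> \<le> 1"
  by (simp add: cross_vtx)

text \<open>Cramer's rule; the determinant \<open>cross (v l) (v m)\<close> is at least
  \<open>\<delta>\<close> in absolute value.\<close>

lemma coordinates_le:
  assumes "l < k" "m < k" "l \<noteq> m"
  shows "\<bar>fst y\<bar> \<le> (\<bar>y \<bullet> v l\<bar> + \<bar>y \<bullet> v m\<bar>) / \<delta>" "\<bar>snd y\<bar> \<le> (\<bar>y \<bullet> v l\<bar> + \<bar>y \<bullet> v m\<bar>) / \<delta>"
proof -
  have le: "\<bar>c\<bar> \<le> (\<bar>y \<bullet> v l\<bar> + \<bar>y \<bullet> v m\<bar>) / \<delta>"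
    if c: "c * cross (v l) (v m) = (y \<bullet> v l) * a - (y \<bullet> v m) * b" and ab: "\<bar>a\<bar> \<le> 1" "\<bar>b\<bar> \<le> 1" for a b c
  proof -
    have "\<bar>c\<bar> * \<delta> \<le> \<bar>c\<bar> * \<bar>cross (v l) (v m)\<bar>"
      using \<delta>_le[OF assms] by (intro mult_left_mono) auto
    also have "\<dots> = \<bar>(y \<bullet> v l) * a - (y \<bullet> v m) * b\<bar>" using c by (simp flip: abs_mult)
    also have "\<dots> \<le> \<bar>y \<bullet> v l\<bar> * \<bar>a\<bar> + \<bar>y \<bullet> v m\<bar> * \<bar>b\<bar>"
      by (metis abs_mult abs_triangle_ineq4)
    also have "\<dots> \<le> \<bar>y \<bullet> v l\<bar> * 1 + \<bar>y \<bullet> v m\<bar> * 1"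
      using ab by (intro add_mono mult_left_mono) auto
    finally show ?thesis using \<delta>_pos by (simp add: field_simps)
  qed
  show "\<bar>fst y\<bar> \<le> (\<bar>y \<bullet> v l\<bar> + \<bar>y \<bullet> v m\<bar>) / \<delta>"
    by (rule le[of _ "snd (v m)" "snd (v l)"])
       (auto simp: cross_def inner_pt abs_snd_vtx_le algebra_simps)
  show "\<bar>snd y\<bar> \<le> (\<bar>y \<bullet> v l\<bar> + \<bar>y \<bullet> v m\<bar>) / \<delta>"
    by (rule le[of _ "- fst (v m)" "- fst (v l)"])
       (auto simp: cross_def inner_pt abs_fst_vtx_le algebra_simps)
qed

lemma abs_inner_vtx_le_coordinates: "\<bar>y \<bullet> v l\<bar> \<le> \<bar>fst y\<bar> + \<bar>snd y\<bar>"
proof -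
  have "\<bar>y \<bullet> v l\<bar> \<le> \<bar>fst y\<bar> * \<bar>fst (v l)\<bar> + \<bar>snd y\<bar> * \<bar>snd (v l)\<bar>"
    unfolding inner_pt by (metis abs_mult abs_triangle_ineq)
  also have "\<dots> \<le> \<bar>fst y\<bar> * 1 + \<bar>snd y\<bar> * 1"
    by (intro add_mono mult_left_mono abs_fst_vtx_le abs_snd_vtx_le) auto
  finally show ?thesis by simp
qed

section \<open>The polygons of the process as intersections of k halfplanes\<close>

lemma Kn_iff: "y \<in> Kn k ps \<longleftrightarrow> (\<forall>q\<in>set (0 # ps). \<forall>l<k. - \<rho> \<le> (y - q) \<bullet> v l)"
proof -
  have "y \<in> (+) p ` kgon k \<longleftrightarrow> y - p \<in> kgon k" for p
  proof
    assume "y - p \<in> kgon k"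
    then show "y \<in> (+) p ` kgon k" by (intro image_eqI[of _ _ "y - p"]) simp_all
  qed (elim imageE, simp)
  then show ?thesis unfolding Kn_def by (simp add: kgon_eq)
qed

lemma Kn_snoc: "Kn k (ps @ [p]) = {y \<in> Kn k ps. \<forall>l<k. - \<rho> \<le> (y - p) \<bullet> v l}"
  by (intro set_eqI iffI) (simp_all add: Kn_iff)

text \<open>Each point was drawn from the polygon current at that time; the leading 0 stands for the
  initial polygon.\<close>
definition reachable :: "pt list \<Rightarrow> bool" where
  "reachable ps \<longleftrightarrow> sorted_wrt (\<lambda>q p. \<forall>l<k. - \<rho> \<le> (p - q) \<bullet> v l) (0 # ps)"

lemma reachable_Nil [simp]: "reachable []"
  by (simp add: reachable_def)

lemma reachable_snoc [simp]: "reachable (ps @ [p]) \<longleftrightarrow> reachable ps \<and> p \<in> Kn k ps"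
  by (auto simp: reachable_def Kn_iff sorted_wrt_append simp del: split_paired_All)

text \<open>Translates of one polygon share their edge directions, so for each \<open>l\<close> the
  halfplanes are nested and only the tightest one counts. Thus \<open>k\<close> constraints suffice,
  however many points have been drawn.\<close>

definition edge_level :: "pt list \<Rightarrow> nat \<Rightarrow> real" where
  "edge_level ps l = Max ((\<lambda>q. q \<bullet> v l) ` set (0 # ps)) - \<rho>"

lemma Kn_eq: "Kn k ps = {y. \<forall>l<k. edge_level ps l \<le> y \<bullet> v l}"
proof -
  have "(\<forall>q\<in>set (0 # ps). - \<rho> \<le> (y - q) \<bullet> v l) \<longleftrightarrow> edge_level ps l \<le> y \<bullet> v l" for y l
  proof -
    have "edge_level ps l \<le> y \<bullet> v l \<longleftrightarrow> Max ((\<lambda>q. q \<bullet> v l) ` set (0 # ps)) \<le> y \<bullet> v l + \<rho>"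
      unfolding edge_level_def by (rule diff_le_eq)
    also have "\<dots> \<longleftrightarrow> (\<forall>q\<in>set (0 # ps). q \<bullet> v l \<le> y \<bullet> v l + \<rho>)"
      by (subst Max_le_iff) auto
    also have "\<dots> \<longleftrightarrow> (\<forall>q\<in>set (0 # ps). - \<rho> \<le> (y - q) \<bullet> v l)"
      by (intro ball_cong refl) (auto simp: inner_diff_left)
    finally show ?thesis by simp
  qed
  then show ?thesis unfolding set_eq_iff Kn_iff mem_Collect_eq by blast
qed

lemma Kn_subset_cball: "Kn k ps \<subseteq> cball 0 1"
proof -
  have "kgon k \<subseteq> cball 0 1"
    unfolding kgon_def by (rule hull_minimal) auto
  then show ?thesis by (auto simp: Kn_def)
qed

lemma closed_Kn: "closed (Kn k ps)" and convex_Kn: "convex (Kn k ps)"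
proof -
  have eq: "Kn k ps = (\<Inter>l\<in>{..<k}. {y. v l \<bullet> y \<ge> edge_level ps l})"
    by (auto simp: Kn_eq inner_commute)
  show "closed (Kn k ps)" unfolding eq by (intro closed_INT ballI closed_halfspace_ge)
  show "convex (Kn k ps)" unfolding eq by (intro convex_INT convex_halfspace_ge)
qed

lemma compact_Kn: "compact (Kn k ps)"
  using closed_Kn Kn_subset_cball by (meson bounded_cball bounded_subset compact_eq_bounded_closed)

text \<open>By Helly three edges suffice. Each is fixed by one of the points drawn (or by 0). The
  latest of the three points satisfies the constraints of the other two edges and has distance
  \<open>\<rho>\<close> from its own, so it can be shifted to gain \<open>r\<close> at those two and
  still keep \<open>r\<close> at the third.\<close>

lemma Kn_slack:
  obtains r where "r > 0" "\<And>ps. reachable ps \<Longrightarrow> \<exists>z. \<forall>l<k. edge_level ps l + r \<le> z \<bullet> v l"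
proof -
  \<comment> \<open>The shift by \<open>r *\<^sub>R u\<close> costs at most
    \<open>r * (4 / \<delta>)\<close> at the third edge, since each coordinate of \<open>u\<close>
    is at most \<open>2 / \<delta>\<close>; \<open>r\<close> solves
    \<open>r + r * (4 / \<delta>) = \<rho>\<close>.\<close>
  define r where "r = \<rho> / (1 + 4 / \<delta>)"
  have pos: "1 + 4 / \<delta> > 0" using \<delta>_pos by (simp add: add_pos_pos)
  have r: "r > 0" using pos rho_pos by (simp add: r_def)
  have "r * (1 + 4 / \<delta>) = \<rho>"
    using pos unfolding r_def by (subst nonzero_eq_divide_eq[symmetric]) auto
  then have r': "r + r * (4 / \<delta>) = \<rho>"
    by (simp only: distrib_left mult_1_right)
  have move: "\<exists>y. edge_level ps l + r \<le> y \<bullet> v l \<and> edge_level ps m + r \<le> y \<bullet> v m \<and> edge_level ps n + r \<le> y \<bullet> v n"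
    if lm: "l < k" "m < k" "l \<noteq> m" and Q: "edge_level ps l \<le> Q \<bullet> v l" "edge_level ps m \<le> Q \<bullet> v m" "edge_level ps n + \<rho> \<le> Q \<bullet> v n"
    for ps l m n Q
  proof -
    obtain u where u: "u \<bullet> v l = 1" "u \<bullet> v m = 1"
      using linear_system_solution cross_vtx_nonzero lm by blast
    have "\<bar>u \<bullet> v n\<bar> \<le> 4 / \<delta>"
      using abs_inner_vtx_le_coordinates[of u n] coordinates_le[OF lm, of u] u by simp
    then have "r * \<bar>u \<bullet> v n\<bar> \<le> r * (4 / \<delta>)" using r by (intro mult_left_mono) auto
    moreover have "- (r * \<bar>u \<bullet> v n\<bar>) \<le> r * (u \<bullet> v n)"
      using r by (metis abs_ge_minus_self abs_mult abs_of_pos minus_le_iff)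
    ultimately show ?thesis using Q u r'
      by (intro exI[of _ "Q + r *\<^sub>R u"]) (auto simp: inner_add_left)
  qed
  have "\<exists>z. \<forall>l<k. edge_level ps l + r \<le> z \<bullet> v l" if ps: "reachable ps" for ps
  proof (rule helly_halfplanes)
    fix l m n assume lmn: "l < k" "m < k" "n < k" "l \<noteq> m" "l \<noteq> n" "m \<noteq> n"
    let ?Q = "\<lambda>i. (0 # ps) ! i"
    have ex: "\<exists>i<length (0 # ps). ?Q i \<bullet> v l = edge_level ps l + \<rho>" for l
    proof -
      have "Max ((\<lambda>q. q \<bullet> v l) ` set (0 # ps)) \<in> (\<lambda>q. q \<bullet> v l) ` set (0 # ps)"
        by (rule Max_in) auto
      then obtain q where "q \<in> set (0 # ps)" "Max ((\<lambda>q. q \<bullet> v l) ` set (0 # ps)) = q \<bullet> v l"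
        by blast
      then show ?thesis unfolding edge_level_def by (metis add.commute diff_add_cancel in_set_conv_nth)
    qed
    have later: "edge_level ps l \<le> ?Q j \<bullet> v l"
      if "?Q i \<bullet> v l = edge_level ps l + \<rho>" "i \<le> j" "j < length (0 # ps)" "l < k" for i j l
    proof (cases "i = j")
      case True
      then show ?thesis using that rho_pos by simp
    next
      case False
      then have "- \<rho> \<le> (?Q j - ?Q i) \<bullet> v l"
        using ps that unfolding reachable_def by (auto simp: sorted_wrt_iff_nth_less)
      then show ?thesis using that by (simp add: inner_diff_left)
    qed
    obtain a b c where abc: "a < length (0 # ps)" "?Q a \<bullet> v l = edge_level ps l + \<rho>"
      "b < length (0 # ps)" "?Q b \<bullet> v m = edge_level ps m + \<rho>"
      "c < length (0 # ps)" "?Q c \<bullet> v n = edge_level ps n + \<rho>"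
      using ex by meson
    \<comment> \<open>Which of the three determining points was drawn last.\<close>
    consider "a \<le> c" "b \<le> c" | "a \<le> b" "c \<le> b" | "b \<le> a" "c \<le> a" by linarith
    then show "\<exists>y. edge_level ps l + r \<le> y \<bullet> v l \<and> edge_level ps m + r \<le> y \<bullet> v m \<and> edge_level ps n + r \<le> y \<bullet> v n"
    proof cases
      case 1
      have "\<exists>y. edge_level ps l + r \<le> y \<bullet> v l \<and> edge_level ps m + r \<le> y \<bullet> v m \<and> edge_level ps n + r \<le> y \<bullet> v n"
        by (rule move[of l m ps "?Q c"]) (use 1 abc lmn later[of a l c] later[of b m c] in simp_all)
      then show ?thesis by blast
    next
      case 2
      have "\<exists>y. edge_level ps l + r \<le> y \<bullet> v l \<and> edge_level ps n + r \<le> y \<bullet> v n \<and> edge_level ps m + r \<le> y \<bullet> v m"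
        by (rule move[of l n ps "?Q b"]) (use 2 abc lmn later[of a l b] later[of c n b] in simp_all)
      then show ?thesis by blast
    next
      case 3
      have "\<exists>y. edge_level ps m + r \<le> y \<bullet> v m \<and> edge_level ps n + r \<le> y \<bullet> v n \<and> edge_level ps l + r \<le> y \<bullet> v l"
        by (rule move[of m n ps "?Q a"]) (use 3 abc lmn later[of b m a] later[of c n a] in simp_all)
      then show ?thesis by blast
    qed
  qed
  then show ?thesis using r that by blast
qed

section \<open>Uniform lower bound on the area, and the area near an apex\<close>

lemma fmeasurable_Kn: "Kn k ps \<in> fmeasurable lborel"
  by (rule fmeasurable_compact[OF compact_Kn])

lemma area_lower_bound:
  obtains c where "c > 0" "\<And>ps. reachable ps \<Longrightarrow> c \<le> measure lborel (Kn k ps)"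
proof -
  obtain r where r: "r > 0" "\<And>ps. reachable ps \<Longrightarrow> \<exists>z. \<forall>l<k. edge_level ps l + r \<le> z \<bullet> v l"
    using Kn_slack by blast
  have "r\<^sup>2 \<le> measure lborel (Kn k ps)" if ps: "reachable ps" for ps
  proof -
    obtain z where z: "\<forall>l<k. edge_level ps l + r \<le> z \<bullet> v l" using r(2)[OF ps] by (elim exE)
    \<comment> \<open>Half-side \<open>r/2\<close>, because a functional \<open>v l\<close> is
      bounded by the sum of the two absolute coordinates.\<close>
    have "cbox (z - (r/2, r/2)) (z + (r/2, r/2)) \<subseteq> Kn k ps"
    proof
      fix y assume "y \<in> cbox (z - (r/2, r/2)) (z + (r/2, r/2))"
      then have "\<bar>fst (y - z)\<bar> \<le> r/2" "\<bar>snd (y - z)\<bar> \<le> r/2"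
        by (simp_all only: mem_cbox_pt)
      then have "\<bar>(y - z) \<bullet> v l\<bar> \<le> r" for l
        using abs_inner_vtx_le_coordinates[of "y - z" l] by linarith
      then have y: "z \<bullet> v l \<le> y \<bullet> v l + r" for l
        by (simp add: inner_diff_left abs_le_iff algebra_simps)
      show "y \<in> Kn k ps" unfolding Kn_eq
      proof (intro CollectI allI impI)
        fix l assume "l < k"
        then show "edge_level ps l \<le> y \<bullet> v l" using z y[of l] by fastforce
      qed
    qed
    then have "measure lborel (cbox (z - (r/2, r/2)) (z + (r/2, r/2))) \<le> measure lborel (Kn k ps)"
      using fmeasurable_Kn by (intro measure_mono_fmeasurable) auto
    then show ?thesis using r(1) measure_lborel_cbox_pt[of "r/2" z] by simp
  qed
  then show ?thesis using r(1) by (intro that[of "r\<^sup>2"]) simp_all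
qed

lemma Kn_nonempty: "reachable ps \<Longrightarrow> Kn k ps \<noteq> {}"
  by (rule area_lower_bound) fastforce

text \<open>Two edges \<open>l\<close>, \<open>m\<close> already bound \<open>v j\<close> from above
  by \<open>\<tau> + t\<close>. In the wedge they form, \<open>v j\<close> decreases at a rate of at
  least \<open>\<delta>\<close> in each of the coordinates given by \<open>v l\<close> and
  \<open>v m\<close>, so the strip fits into a box of side of order \<open>t\<close> around the apex
  of the wedge.\<close>

lemma strip_area:
  assumes ps: "reachable ps" and j: "j < k" and t: "t > 0"
    and \<tau>: "\<And>y. y \<in> Kn k ps \<Longrightarrow> y \<bullet> v j \<le> \<tau>"
  shows "measure lborel {p \<in> Kn k ps. \<tau> - t \<le> p \<bullet> v j} \<le> (8 * t / \<delta>\<^sup>2)\<^sup>2"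
proof -
  \<comment> \<open>The constraint of edge \<open>j\<close> is replaced by one that no point of the
    polygon meets; Helly then exhibits three constraints that already conflict.\<close>
  define b where "b = (edge_level ps)(j := \<tau> + t)"
  have bj: "b j = \<tau> + t" and b: "l \<noteq> j \<Longrightarrow> b l = edge_level ps l" for l
    by (simp_all add: b_def)
  obtain q where q: "q \<in> Kn k ps" using Kn_nonempty[OF ps] by blast
  have infeasible: "\<not> (\<exists>y. \<forall>l<k. b l \<le> y \<bullet> v l)"
  proof
    assume "\<exists>y. \<forall>l<k. b l \<le> y \<bullet> v l"
    then obtain y where y: "\<forall>l<k. b l \<le> y \<bullet> v l" by blast
    have yj: "\<tau> + t \<le> y \<bullet> v j" using y[rule_format, OF j] by (simp only: bj)
    have "edge_level ps j \<le> \<tau>" using q \<tau>[OF q] j by (force simp: Kn_eq)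
    then have "edge_level ps j \<le> y \<bullet> v j" using yj t by simp
    then have "edge_level ps l \<le> y \<bullet> v l" if "l < k" for l
      using y[rule_format, OF that] by (cases "l = j") (simp_all add: b)
    then have "y \<in> Kn k ps" by (simp add: Kn_eq)
    then show False using yj \<tau>[of y] t by simp
  qed
  obtain l m where lm: "l < k" "m < k" "l \<noteq> m" "l \<noteq> j" "m \<noteq> j"
    and inf: "\<And>y. edge_level ps l \<le> y \<bullet> v l \<Longrightarrow> edge_level ps m \<le> y \<bullet> v m \<Longrightarrow> y \<bullet> v j < \<tau> + t"
  proof -
    have "\<exists>l m n. l < k \<and> m < k \<and> n < k \<and> l \<noteq> m \<and> l \<noteq> n \<and> m \<noteq> n \<and>
      \<not> (\<exists>y. b l \<le> y \<bullet> v l \<and> b m \<le> y \<bullet> v m \<and> b n \<le> y \<bullet> v n)"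
      by (rule ccontr, rule notE[OF infeasible], rule helly_halfplanes) blast
    then obtain l m n where lmn: "l < k" "m < k" "n < k" "l \<noteq> m" "l \<noteq> n" "m \<noteq> n"
      and "\<not> (\<exists>y. b l \<le> y \<bullet> v l \<and> b m \<le> y \<bullet> v m \<and> b n \<le> y \<bullet> v n)"
      by blast
    then have no: "\<not> (b l \<le> y \<bullet> v l \<and> b m \<le> y \<bullet> v m \<and> b n \<le> y \<bullet> v n)" for y by blast
    have qq: "edge_level ps l \<le> q \<bullet> v l" "edge_level ps m \<le> q \<bullet> v m" "edge_level ps n \<le> q \<bullet> v n"
      using q lmn by (auto simp: Kn_eq)
    \<comment> \<open>Edge \<open>j\<close> must be among the three, since \<open>q\<close>
      satisfies all the other constraints.\<close>
    consider "l = j" | "m = j" | "n = j" | "l \<noteq> j" "m \<noteq> j" "n \<noteq> j" by blast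
    then show thesis
    proof cases
      case 1
      have "y \<bullet> v j < \<tau> + t" if "edge_level ps m \<le> y \<bullet> v m" "edge_level ps n \<le> y \<bullet> v n" for y
        using no[of y] 1 lmn that by (simp add: bj b)
      with 1 show thesis using lmn by (intro that[of m n]) auto
    next
      case 2
      have "y \<bullet> v j < \<tau> + t" if "edge_level ps l \<le> y \<bullet> v l" "edge_level ps n \<le> y \<bullet> v n" for y
        using no[of y] 2 lmn that by (simp add: bj b)
      with 2 show thesis using lmn by (intro that[of l n]) auto
    next
      case 3
      have "y \<bullet> v j < \<tau> + t" if "edge_level ps l \<le> y \<bullet> v l" "edge_level ps m \<le> y \<bullet> v m" for y
        using no[of y] 3 lmn that by (simp add: bj b)
      with 3 show thesis using lmn by (intro that[of l m]) auto
    next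
      case 4
      then show thesis using no[of q] qq by (simp add: b)
    qed
  qed
  define D where "D = cross (v l) (v m)"
  define \<alpha> where "\<alpha> = cross (v j) (v m) / D"
  define \<beta> where "\<beta> = cross (v l) (v j) / D"
  have D: "D \<noteq> 0" "\<bar>D\<bar> \<le> 1" using cross_vtx_nonzero lm abs_cross_le by (auto simp: D_def)
  have decomp: "y \<bullet> v j = \<alpha> * (y \<bullet> v l) + \<beta> * (y \<bullet> v m)" for y
  proof -
    have "D * (y \<bullet> v j) = cross (v j) (v m) * (y \<bullet> v l) + cross (v l) (v j) * (y \<bullet> v m)"
      by (simp add: D_def cross_def inner_pt algebra_simps)
    then show ?thesis using D(1) by (simp add: \<alpha>_def \<beta>_def field_simps)
  qed
  \<comment> \<open>Dividing by \<open>D\<close> can only enlarge a coefficient, as \<open>D\<close>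
    is a sine.\<close>
  have \<delta>D: "\<delta> \<le> \<bar>c / D\<bar>" if "\<delta> \<le> \<bar>c\<bar>" for c
  proof -
    have "\<bar>c\<bar> * 1 \<le> \<bar>c\<bar> / \<bar>D\<bar>" using D by (simp add: field_simps mult_left_le_one_le)
    then show ?thesis using that by (simp add: abs_divide)
  qed
  have \<alpha>\<beta>: "\<delta> \<le> \<bar>\<alpha>\<bar>" "\<delta> \<le> \<bar>\<beta>\<bar>"
    using \<delta>D[OF \<delta>_le[of j m]] \<delta>D[OF \<delta>_le[of l j]] lm j by (simp_all add: \<alpha>_def \<beta>_def)
  let ?a = "edge_level ps l" and ?c = "edge_level ps m"
  have bd: "\<alpha> * (?a + \<xi>) + \<beta> * (?c + \<eta>) < \<tau> + t" if "\<xi> \<ge> 0" "\<eta> \<ge> 0" for \<xi> \<eta>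
  proof -
    obtain y where "y \<bullet> v l = ?a + \<xi>" "y \<bullet> v m = ?c + \<eta>"
      using linear_system_solution cross_vtx_nonzero lm by blast
    then show ?thesis using inf[of y] decomp[of y] that by simp
  qed
  \<comment> \<open>A linear function bounded above on a ray has nonpositive slope; this is applied
    along both sides of the wedge.\<close>
  have neg: "\<gamma> \<le> 0" if "\<And>\<xi>. \<xi> \<ge> 0 \<Longrightarrow> A + \<gamma> * \<xi> < B" for \<gamma> A B :: real
  proof (rule ccontr)
    assume "\<not> \<gamma> \<le> 0"
    then have "A + \<bar>B - A\<bar> < B" using that[of "\<bar>B - A\<bar> / \<gamma>"] by simp
    then show False by linarith
  qed
  have "\<alpha> \<le> 0"
    using bd[where \<eta> = 0] by (intro neg[of "\<alpha> * ?a + \<beta> * ?c" _ "\<tau> + t"]) (simp add: algebra_simps)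
  then have \<alpha>: "\<delta> \<le> - \<alpha>" using \<alpha>\<beta> by simp
  have "\<beta> \<le> 0"
    using bd[where \<xi> = 0] by (intro neg[of "\<alpha> * ?a + \<beta> * ?c" _ "\<tau> + t"]) (simp add: algebra_simps)
  then have \<beta>: "\<delta> \<le> - \<beta>" using \<alpha>\<beta> by simp
  \<comment> \<open>The apex of the wedge; it need not belong to the polygon.\<close>
  obtain y0 where y0: "y0 \<bullet> v l = ?a" "y0 \<bullet> v m = ?c"
    using linear_system_solution cross_vtx_nonzero lm by blast
  let ?r = "4 * t / \<delta>\<^sup>2"
  have "{p \<in> Kn k ps. \<tau> - t \<le> p \<bullet> v j} \<subseteq> cbox (y0 - (?r, ?r)) (y0 + (?r, ?r))"
  proof safe
    fix p assume p: "p \<in> Kn k ps" "\<tau> - t \<le> p \<bullet> v j"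
    define \<xi> where "\<xi> = (p - y0) \<bullet> v l"
    define \<eta> where "\<eta> = (p - y0) \<bullet> v m"
    have ge: "\<xi> \<ge> 0" "\<eta> \<ge> 0"
      using p(1) lm y0 by (auto simp: \<xi>_def \<eta>_def Kn_eq inner_diff_left)
    have "p \<bullet> v j = (\<alpha> * ?a + \<beta> * ?c) + \<alpha> * \<xi> + \<beta> * \<eta>"
      unfolding decomp[of p] \<xi>_def \<eta>_def by (simp add: inner_diff_left y0 algebra_simps)
    then have "(- \<alpha>) * \<xi> + (- \<beta>) * \<eta> \<le> 2 * t"
      using p(2) bd[of 0 0] by simp
    moreover have "\<delta> * \<xi> \<le> (- \<alpha>) * \<xi>" "\<delta> * \<eta> \<le> (- \<beta>) * \<eta>"
      using \<alpha> \<beta> ge by (intro mult_right_mono; simp)+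
    moreover have "0 \<le> \<delta> * \<xi>" "0 \<le> \<delta> * \<eta>" using ge \<delta>_pos by auto
    ultimately have "\<delta> * (\<bar>\<xi>\<bar> + \<bar>\<eta>\<bar>) \<le> 4 * t" using ge t by (simp add: distrib_left)
    then have "\<bar>\<xi>\<bar> + \<bar>\<eta>\<bar> \<le> 4 * t / \<delta>"
      using \<delta>_pos by (simp add: pos_le_divide_eq mult.commute)
    then have "(\<bar>\<xi>\<bar> + \<bar>\<eta>\<bar>) / \<delta> \<le> 4 * t / \<delta> / \<delta>"
      using \<delta>_pos by (intro divide_right_mono) auto
    then have "(\<bar>\<xi>\<bar> + \<bar>\<eta>\<bar>) / \<delta> \<le> ?r"
      by (simp add: power2_eq_square)
    then have "\<bar>fst (p - y0)\<bar> \<le> ?r" "\<bar>snd (p - y0)\<bar> \<le> ?r"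
      using coordinates_le[OF lm(1-3), of "p - y0"] unfolding \<xi>_def \<eta>_def by linarith+
    then show "p \<in> cbox (y0 - (?r, ?r)) (y0 + (?r, ?r))"
      by (simp only: mem_cbox_pt)
  qed
  moreover have "{p \<in> Kn k ps. \<tau> - t \<le> p \<bullet> v j} \<in> sets lborel"
  proof -
    have "closed ({p. v j \<bullet> p \<ge> \<tau> - t} \<inter> Kn k ps)"
      by (intro closed_Int closed_halfspace_ge closed_Kn)
    then show ?thesis by (simp add: Collect_conj_eq inner_commute Int_commute)
  qed
  ultimately have "measure lborel {p \<in> Kn k ps. \<tau> - t \<le> p \<bullet> v j}
      \<le> measure lborel (cbox (y0 - (?r, ?r)) (y0 + (?r, ?r)))"
    by (intro measure_mono_fmeasurable) auto
  also have "\<dots> = (8 * t / \<delta>\<^sup>2)\<^sup>2"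
    using t measure_lborel_cbox_pt[of ?r y0] by simp
  finally show ?thesis .
qed

section \<open>One step of the process\<close>

lemma continuous_inner_on: "continuous_on S (\<lambda>y::pt. y \<bullet> w)"
  by (intro continuous_intros)

lemma height_attained:
  assumes "Kn k ps \<noteq> {}"
  obtains q z where "q \<in> Kn k ps" "z \<in> Kn k ps" "height k ps i = q \<bullet> v i - z \<bullet> v i"
    "\<And>y. y \<in> Kn k ps \<Longrightarrow> z \<bullet> v i \<le> y \<bullet> v i \<and> y \<bullet> v i \<le> q \<bullet> v i"
proof -
  obtain q where q: "q \<in> Kn k ps" "\<forall>y\<in>Kn k ps. y \<bullet> v i \<le> q \<bullet> v i"
    using continuous_attains_sup[OF compact_Kn assms continuous_inner_on] by blast
  obtain z where z: "z \<in> Kn k ps" "\<forall>y\<in>Kn k ps. z \<bullet> v i \<le> y \<bullet> v i"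
    using continuous_attains_inf[OF compact_Kn assms continuous_inner_on] by blast
  have "(SUP y\<in>Kn k ps. y \<bullet> v i) = q \<bullet> v i" using q by (intro cSup_eq_maximum) auto
  moreover have "(INF y\<in>Kn k ps. y \<bullet> v i) = z \<bullet> v i" using z by (intro cInf_eq_minimum) auto
  ultimately show ?thesis using that[OF q(1) z(1)] q(2) z(2) by (simp add: height_def)
qed

lemma height_ge:
  assumes "y \<in> Kn k ps" "y' \<in> Kn k ps"
  shows "y \<bullet> v i - y' \<bullet> v i \<le> height k ps i"
proof -
  have "Kn k ps \<noteq> {}" using assms by auto
  then obtain q z where "height k ps i = q \<bullet> v i - z \<bullet> v i"
    "\<And>y. y \<in> Kn k ps \<Longrightarrow> z \<bullet> v i \<le> y \<bullet> v i \<and> y \<bullet> v i \<le> q \<bullet> v i"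
    by (rule height_attained[where i = i]) blast
  then have "y \<bullet> v i \<le> q \<bullet> v i" "z \<bullet> v i \<le> y' \<bullet> v i" using assms by blast+
  with \<open>height k ps i = _\<close> show ?thesis by simp
qed

lemma height_antimono:
  assumes "Kn k ps' \<subseteq> Kn k ps" "Kn k ps' \<noteq> {}"
  shows "height k ps' i \<le> height k ps i"
proof -
  obtain q z where "q \<in> Kn k ps'" "z \<in> Kn k ps'" "height k ps' i = q \<bullet> v i - z \<bullet> v i"
    by (rule height_attained[OF assms(2), where i = i]) blast
  then show ?thesis using assms(1) height_ge[of q ps z i] by auto
qed

lemma maxheight_le_iff: "maxheight k ps \<le> c \<longleftrightarrow> (\<forall>i<k. height k ps i \<le> c)"
  unfolding maxheight_def using k_pos by (subst Max_le_iff) auto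

text \<open>The start for the survival argument. The second witness,
  \<open>- \<rho> *\<^sub>R v 0\<close>, is the midpoint of the edge opposite vertex 0.\<close>

lemma maxheight_Nil: "maxheight k [] \<ge> 1 + \<rho>"
proof -
  have zero: "0 < k" and k: "Kn k [] = kgon k" using k_pos by (auto simp: Kn_def)
  have v0: "v 0 \<in> Kn k []"
    unfolding k kgon_def using zero by (auto intro: hull_inc)
  define y where "y = - \<rho> *\<^sub>R v 0"
  have "y \<in> Kn k []"
    unfolding k kgon_eq
  proof (intro CollectI allI impI)
    fix l assume "l < k"
    have "v 0 \<bullet> v l \<le> 1" by (simp add: vtx_inner)
    then have "\<rho> * (v 0 \<bullet> v l) \<le> \<rho>" using rho_pos by (simp add: mult_left_le)
    then show "- \<rho> \<le> y \<bullet> v l" by (simp add: y_def)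
  qed
  moreover have "v 0 \<bullet> v 0 - y \<bullet> v 0 = 1 + \<rho>" by (simp add: y_def vtx_inner)
  ultimately have "1 + \<rho> \<le> height k [] 0" using height_ge[OF v0] by metis
  also have "\<dots> \<le> maxheight k []" using maxheight_le_iff zero by blast
  finally show ?thesis .
qed

text \<open>Moving from p towards a point z that is cut off, one leaves p + K through some edge j;
  the exit point lies in the new polygon.\<close>
lemma tight_edge:
  assumes p: "p \<in> Kn k ps" and z: "z \<in> Kn k ps" "z \<notin> Kn k (ps @ [p])"
  obtains j y where "j < k" "y \<in> Kn k (ps @ [p])" "y \<bullet> v j = p \<bullet> v j - \<rho>"
proof -
  let ?f = "\<lambda>l. (p - z) \<bullet> v l"
  define D where "D = Max (?f ` {..<k})"
  have D: "?f l \<le> D" if "l < k" for l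
    unfolding D_def using that by (intro Max_ge) auto
  have "D \<in> ?f ` {..<k}" unfolding D_def using k_pos by (intro Max_in) auto
  then obtain j where j: "j < k" "D = ?f j" by blast
  obtain l where l: "l < k" "\<not> - \<rho> \<le> (z - p) \<bullet> v l"
    using z unfolding Kn_snoc by blast
  then have D\<rho>: "\<rho> < D" using D[OF l(1)] by (simp add: inner_diff_left)
  define y where "y = p + (\<rho> / D) *\<^sub>R (z - p)"
  have c: "0 < \<rho> / D" "\<rho> / D \<le> 1" using D\<rho> rho_pos by auto
  have yv: "(y - p) \<bullet> v l = - (\<rho> / D) * ?f l" for l
    by (simp add: y_def inner_diff_left right_diff_distrib)
  have "y = (1 - \<rho> / D) *\<^sub>R p + (\<rho> / D) *\<^sub>R z" by (simp add: y_def algebra_simps)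
  then have "y \<in> Kn k ps" using convexD[OF convex_Kn p z(1)] c by simp
  moreover have "- \<rho> \<le> (y - p) \<bullet> v l" if "l < k" for l
  proof -
    have "(\<rho> / D) * ?f l \<le> (\<rho> / D) * D" using D[OF that] c by (intro mult_left_mono) auto
    then show ?thesis unfolding yv using D\<rho> rho_pos by simp
  qed
  ultimately have "y \<in> Kn k (ps @ [p])" by (simp add: Kn_snoc)
  moreover have "y \<bullet> v j = p \<bullet> v j - \<rho>"
    using yv[of j] j D\<rho> rho_pos by (simp add: inner_diff_left)
  ultimately show ?thesis using j that by blast
qed

text \<open>Two points of the unit disc are at most 2 apart, so this displacement from
  \<open>p\<close> has length at most \<open>\<rho>\<close>, the inradius, and stays inside
  \<open>p + K\<close>.\<close>

lemma shrunk_towards_point: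
  assumes p: "p \<in> Kn k ps" and q: "q \<in> Kn k ps"
  shows "p + (\<rho> / 2) *\<^sub>R (q - p) \<in> Kn k (ps @ [p])"
proof -
  let ?y = "p + (\<rho> / 2) *\<^sub>R (q - p)"
  have "?y = (1 - \<rho> / 2) *\<^sub>R p + (\<rho> / 2) *\<^sub>R q" by (simp add: algebra_simps)
  then have "?y \<in> Kn k ps" using convexD[OF convex_Kn p q, of "1 - \<rho>/2" "\<rho>/2"] rho_pos rho_le by simp
  moreover have "- \<rho> \<le> (?y - p) \<bullet> v l" for l
  proof -
    have "norm (q - p) \<le> 2"
      using norm_triangle_ineq4[of q p] subsetD[OF Kn_subset_cball p] subsetD[OF Kn_subset_cball q] by simp
    then have "\<bar>(q - p) \<bullet> v l\<bar> \<le> 2" using abs_inner_vtx_le[of "q - p" k l] by simp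
    then have "(\<rho> / 2) * (- 2) \<le> (\<rho> / 2) * ((q - p) \<bullet> v l)" 
      using rho_pos by (intro mult_left_mono) auto
    then show ?thesis by simp
  qed
  ultimately show ?thesis by (simp add: Kn_snoc)
qed

text \<open>The polygon must change, so some edge \<open>j\<close> is tight at a point
  \<open>y\<close> lying \<open>\<rho>\<close> below \<open>p\<close>. The shrunk copy of
  \<open>q\<close> lies \<open>(\<rho> / 2) * ((q - p) \<bullet> v j)\<close> above
  \<open>p\<close>. Both survive, and the new \<open>j\<close>-th height leaves only
  \<open>s\<close> for the second distance.\<close>

lemma overshoot_in_strip:
  assumes p: "p \<in> Kn k ps" and s: "maxheight k ps > \<rho> + s" "maxheight k (ps @ [p]) \<le> \<rho> + s"
  shows "\<exists>j<k. \<forall>q\<in>Kn k ps. q \<bullet> v j - 2 * s / \<rho> \<le> p \<bullet> v j"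
proof -
  have "Kn k (ps @ [p]) \<noteq> Kn k ps"
    using s by (auto simp: maxheight_def height_def)
  then obtain z where z: "z \<in> Kn k ps" "z \<notin> Kn k (ps @ [p])" unfolding Kn_snoc by blast
  obtain j y where j: "j < k" "y \<in> Kn k (ps @ [p])" "y \<bullet> v j = p \<bullet> v j - \<rho>"
    by (rule tight_edge[OF p z])
  have "q \<bullet> v j - 2 * s / \<rho> \<le> p \<bullet> v j" if q: "q \<in> Kn k ps" for q
  proof -
    have "(p + (\<rho> / 2) *\<^sub>R (q - p)) \<bullet> v j - y \<bullet> v j \<le> height k (ps @ [p]) j"
      by (rule height_ge[OF shrunk_towards_point[OF p q] j(2)])
    also have "\<dots> \<le> \<rho> + s" using s(2) j(1) maxheight_le_iff by blast
    finally have "(\<rho> / 2) * (q \<bullet> v j - p \<bullet> v j) \<le> s"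
      by (simp add: j(3) inner_add_left inner_diff_left)
    then show ?thesis using rho_pos by (simp add: field_simps)
  qed
  then show ?thesis using j(1) by blast
qed

lemma overshoot_area:
  obtains C where "C > 0"
    "\<And>ps s. \<lbrakk>reachable ps; s > 0; maxheight k ps > \<rho> + s; {p \<in> Kn k ps. maxheight k (ps @ [p]) \<le> \<rho> + s} \<in> sets lborel\<rbrakk> \<Longrightarrow>
      measure lborel {p \<in> Kn k ps. maxheight k (ps @ [p]) \<le> \<rho> + s} \<le> C * s\<^sup>2 * measure lborel (Kn k ps)"
proof -
  obtain c where c: "c > 0" "\<And>ps. reachable ps \<Longrightarrow> c \<le> measure lborel (Kn k ps)"
    using area_lower_bound by blast
  \<comment> \<open>The side \<open>8 * t / \<delta>\<^sup>2\<close> at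
    \<open>t = 2 * s / \<rho>\<close>, squared and with \<open>s\<^sup>2\<close> split off.\<close>
  define B where "B = (16 / (\<rho> * \<delta>\<^sup>2))\<^sup>2"
  have B: "B > 0" using rho_pos \<delta>_pos by (simp add: B_def)
  have "measure lborel {p \<in> Kn k ps. maxheight k (ps @ [p]) \<le> \<rho> + s}
      \<le> (real k * B / c) * s\<^sup>2 * measure lborel (Kn k ps)"
    if ps: "reachable ps" and s: "s > 0" and mh: "maxheight k ps > \<rho> + s"
      and meas: "{p \<in> Kn k ps. maxheight k (ps @ [p]) \<le> \<rho> + s} \<in> sets lborel" for ps s
  proof -
    have "\<exists>\<tau>. \<forall>y\<in>Kn k ps. y \<bullet> v j \<le> \<tau> \<and> (\<exists>q\<in>Kn k ps. \<tau> = q \<bullet> v j)" for j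
      using height_attained[OF Kn_nonempty[OF ps], of j] by metis
    then obtain \<tau> where \<tau>: "\<And>j y. y \<in> Kn k ps \<Longrightarrow> y \<bullet> v j \<le> \<tau> j"
      "\<And>j y. y \<in> Kn k ps \<Longrightarrow> \<exists>q\<in>Kn k ps. \<tau> j = q \<bullet> v j"
      by metis
    define t where "t = 2 * s / \<rho>"
    have t: "t > 0" using s rho_pos by (simp add: t_def)
    define S where "S j = {p \<in> Kn k ps. \<tau> j - t \<le> p \<bullet> v j}" for j
    have S: "S j \<in> sets lborel" for j
    proof -
      have "closed ({p. v j \<bullet> p \<ge> \<tau> j - t} \<inter> Kn k ps)"
        by (intro closed_Int closed_halfspace_ge closed_Kn)
      then show ?thesis by (simp add: S_def Collect_conj_eq inner_commute Int_commute)
    qed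
    have "{p \<in> Kn k ps. maxheight k (ps @ [p]) \<le> \<rho> + s} \<subseteq> (\<Union>j\<in>{..<k}. S j)"
    proof
      fix p assume "p \<in> {p \<in> Kn k ps. maxheight k (ps @ [p]) \<le> \<rho> + s}"
      then have p: "p \<in> Kn k ps" "maxheight k (ps @ [p]) \<le> \<rho> + s" by auto
      then obtain j where j: "j < k" "\<forall>q\<in>Kn k ps. q \<bullet> v j - t \<le> p \<bullet> v j"
        unfolding t_def using overshoot_in_strip[OF p(1) mh p(2)] by (elim exE conjE)
      obtain q where "q \<in> Kn k ps" "\<tau> j = q \<bullet> v j" using \<tau>(2)[OF p(1), of j] by (elim bexE)
      then have "p \<in> S j" using j(2)[rule_format, of q] p(1) by (simp add: S_def)
      then show "p \<in> (\<Union>j\<in>{..<k}. S j)" using j(1) by blast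
    qed
    moreover have fS: "S j \<in> fmeasurable lborel" for j
      by (rule fmeasurableI2[OF fmeasurable_Kn[of ps] _ S]) (auto simp: S_def)
    ultimately have "measure lborel {p \<in> Kn k ps. maxheight k (ps @ [p]) \<le> \<rho> + s}
        \<le> measure lborel (\<Union>j\<in>{..<k}. S j)"
      using meas by (intro measure_mono_fmeasurable fmeasurable.finite_UN) auto
    also have "\<dots> \<le> (\<Sum>j<k. measure lborel (S j))"
      using S by (intro measure_UNION_le) auto
    also have "\<dots> \<le> (\<Sum>j<k. (8 * t / \<delta>\<^sup>2)\<^sup>2)"
      unfolding S_def using strip_area[OF ps _ t \<tau>(1)] by (intro sum_mono) auto
    also have "\<dots> = real k * B * s\<^sup>2"
      by (simp add: B_def t_def power_mult_distrib power_divide)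
    also have "\<dots> = (real k * B / c) * s\<^sup>2 * c" using c(1) by simp
    also have "\<dots> \<le> (real k * B / c) * s\<^sup>2 * measure lborel (Kn k ps)"
      using c(1) c(2)[OF ps] B by (intro mult_left_mono) auto
    finally show ?thesis .
  qed
  moreover have "real k * B / c > 0" using B c k_pos by simp
  ultimately show ?thesis using that by blast
qed

text \<open>The homothetic copy of the polygon at its apex in direction v i, with ratio s/2, has
  vertical extent at most s because the polygon has diameter at most 2.\<close>
lemma shrink_area:
  assumes ps: "reachable ps" and s: "0 < s" "s \<le> 2"
    and meas: "{p \<in> Kn k ps. height k (ps @ [p]) i \<le> \<rho> + s} \<in> sets lborel"
    and i: "i < k"
  shows "s\<^sup>2 / 4 * measure lborel (Kn k ps) \<le> measure lborel {p \<in> Kn k ps. height k (ps @ [p]) i \<le> \<rho> + s}"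
proof -
  obtain q where q: "q \<in> Kn k ps" "\<And>y. y \<in> Kn k ps \<Longrightarrow> y \<bullet> v i \<le> q \<bullet> v i"
    by (rule height_attained[OF Kn_nonempty[OF ps], where i = i]) blast
  define T where "T = (\<lambda>y. (s/2) *\<^sub>R y + (1 - s/2) *\<^sub>R q)"
  have comp: "compact (T ` Kn k ps)"
    unfolding T_def by (intro compact_continuous_image continuous_intros compact_Kn)
  have "T ` Kn k ps \<subseteq> {p \<in> Kn k ps. height k (ps @ [p]) i \<le> \<rho> + s}"
  proof (rule image_subsetI)
    fix y assume y: "y \<in> Kn k ps"
    have Ty: "T y \<in> Kn k ps"
      unfolding T_def using convexD[OF convex_Kn y q(1)] s by simp
    have "norm (q - y) \<le> 2"
      using norm_triangle_ineq4[of q y] subsetD[OF Kn_subset_cball y] subsetD[OF Kn_subset_cball q(1)] by simp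
    then have "\<bar>(q - y) \<bullet> v i\<bar> \<le> 2" using abs_inner_vtx_le[of "q - y" k i] by simp
    then have "(s/2) * ((q - y) \<bullet> v i) \<le> (s/2) * 2" using s by (intro mult_left_mono) auto
    moreover have "T y \<bullet> v i = q \<bullet> v i - (s/2) * ((q - y) \<bullet> v i)"
      by (simp add: T_def inner_add_left inner_diff_left algebra_simps)
    ultimately have low: "q \<bullet> v i - s \<le> T y \<bullet> v i" by simp
    have "T y \<in> Kn k (ps @ [T y])" using Ty rho_pos by (simp add: Kn_snoc)
    then obtain a b where ab: "a \<in> Kn k (ps @ [T y])" "b \<in> Kn k (ps @ [T y])"
      "height k (ps @ [T y]) i = a \<bullet> v i - b \<bullet> v i"
      using height_attained[of "ps @ [T y]" i thesis] by blast
    \<comment> \<open>The new polygon lies above the tight level \<open>\<rho>\<close> below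
      \<open>T y\<close>, and below the old apex \<open>q\<close>, which is at most \<open>s\<close>
      above \<open>T y\<close>.\<close>
    have "- \<rho> \<le> (b - T y) \<bullet> v i" using ab(2) i by (simp add: Kn_snoc)
    moreover have "a \<bullet> v i \<le> q \<bullet> v i" using ab(1) q(2) by (simp add: Kn_snoc)
    ultimately have "height k (ps @ [T y]) i \<le> \<rho> + s"
      using low ab(3) by (simp add: inner_diff_left)
    with Ty show "T y \<in> {p \<in> Kn k ps. height k (ps @ [p]) i \<le> \<rho> + s}" by simp
  qed
  then have "measure lborel (T ` Kn k ps) \<le> measure lborel {p \<in> Kn k ps. height k (ps @ [p]) i \<le> \<rho> + s}"
    using comp by (intro measure_mono_fmeasurable fmeasurableI2[OF fmeasurable_Kn[of ps] _ meas])
      (auto intro: borel_compact)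
  moreover have "measure lborel (T ` Kn k ps) = s\<^sup>2 / 4 * measure lborel (Kn k ps)"
  proof -
    have "measure lebesgue (T ` Kn k ps) = \<bar>s/2\<bar> ^ DIM(pt) * measure lebesgue (Kn k ps)"
      unfolding T_def by (rule measure_lebesgue_affine)
    moreover have "T ` Kn k ps \<in> sets lborel" "Kn k ps \<in> sets lborel"
      using comp compact_Kn by (auto intro: borel_compact)
    ultimately show ?thesis by (simp add: power2_eq_square)
  qed
  ultimately show ?thesis by simp
qed

end

section \<open>Measurability\<close>

text \<open>Lists of length \<open>n\<close> are read off infinite sequences, so one product space
  serves all lengths and appending a point becomes \<open>fun_upd\<close>. All lists are included,
  even those whose polygon is empty.\<close>

definition list_measurable :: "(pt list \<Rightarrow> real) \<Rightarrow> bool" where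
  "list_measurable F \<longleftrightarrow>
    (\<forall>n. (\<lambda>\<omega>. F (map \<omega> [0..<n])) \<in> borel_measurable (PiM UNIV (\<lambda>_::nat. borel)))"

lemma list_measurableD:
  "list_measurable F \<Longrightarrow> (\<lambda>\<omega>. F (map \<omega> [0..<n])) \<in> borel_measurable (PiM UNIV (\<lambda>_::nat. borel))"
  by (simp add: list_measurable_def)

lemma map_upt_snoc: "map \<omega> [0..<n] @ [p] = map (fun_upd \<omega> n p) [0..<Suc n]"
  by (rule nth_equalityI) (auto simp: nth_append)

lemma list_measurable_snoc_pair:
  assumes "list_measurable F"
  shows "(\<lambda>(\<omega>, p). F (map \<omega> [0..<n] @ [p])) \<in> borel_measurable (PiM UNIV (\<lambda>_::nat. borel) \<Otimes>\<^sub>M lborel)"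
proof -
  have "(\<lambda>x. fun_upd (fst x) n (snd x)) \<in> (PiM UNIV (\<lambda>_::nat. borel::pt measure) \<Otimes>\<^sub>M lborel) \<rightarrow>\<^sub>M PiM UNIV (\<lambda>_::nat. borel)"
    by (rule measurable_fun_upd[where J = UNIV]) auto
  from measurable_compose[OF this list_measurableD[OF assms, of "Suc n"]]
  show ?thesis unfolding map_upt_snoc by (simp add: case_prod_beta')
qed

lemma list_measurable_snoc:
  assumes "list_measurable F"
  shows "(\<lambda>p. F (ps @ [p])) \<in> borel_measurable lborel"
proof -
  have ps: "map ((!) ps) [0..<length ps] = ps" by (rule map_nth)
  have "(\<lambda>p. ((!) ps, p)) \<in> lborel \<rightarrow>\<^sub>M (PiM UNIV (\<lambda>_::nat. borel) \<Otimes>\<^sub>M lborel)"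
    by (intro measurable_Pair1') (simp add: space_PiM)
  from measurable_compose[OF this list_measurable_snoc_pair[OF assms, of "length ps"]]
  show ?thesis by (simp add: ps)
qed

lemma list_measurable_indicator_le:
  fixes m :: nat
  assumes "\<And>i. i < m \<Longrightarrow> list_measurable (H i)"
  shows "list_measurable (\<lambda>ps. of_bool (\<forall>i<m. H i ps \<le> c))"
  unfolding list_measurable_def
proof
  fix n
  have H: "Measurable.pred (PiM UNIV (\<lambda>_::nat. borel)) (\<lambda>\<omega>. H i (map \<omega> [0..<n]) \<le> c)" if "i < m" for i
    using list_measurableD[OF assms[OF that]] by measurable
  have "Measurable.pred (PiM UNIV (\<lambda>_::nat. borel)) (\<lambda>\<omega>. \<forall>i\<in>{..<m}. H i (map \<omega> [0..<n]) \<le> c)"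
    by (rule pred_intros_finite(3)[OF finite_lessThan]) (rule H, simp)
  then show "(\<lambda>\<omega>. of_bool (\<forall>i<m. H i (map \<omega> [0..<n]) \<le> c)::real) \<in> borel_measurable (PiM UNIV (\<lambda>_::nat. borel))"
    unfolding of_bool_def pred_def Ball_def lessThan_iff
    by (rule measurable_If[OF borel_measurable_const borel_measurable_const])
qed

context odd_polygon
begin

lemma Kn_map_upt_iff:
  "y \<in> Kn k (map \<omega> [0..<n]) \<longleftrightarrow>
    (\<forall>l<k. - \<rho> \<le> y \<bullet> v l) \<and> (\<forall>m\<in>{..<n}. \<forall>l\<in>{..<k}. - \<rho> \<le> (y - \<omega> m) \<bullet> v l)"
  by (auto simp: Kn_iff)

lemma closed_graph_Kn: "closed {x. snd x \<in> Kn k (map (fst x) [0..<n])}"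
proof -
  have 1: "closed {x :: (nat \<Rightarrow> pt) \<times> pt. - \<rho> \<le> snd x \<bullet> v l}" for l
    by (intro closed_Collect_le continuous_intros)
  have 2: "closed {x :: (nat \<Rightarrow> pt) \<times> pt. - \<rho> \<le> (snd x - fst x m) \<bullet> v l}" for l m
    by (rule closed_Collect_le, rule continuous_on_const,
        intro continuous_on_inner continuous_on_diff continuous_on_snd continuous_on_id continuous_on_const
          continuous_on_product_then_coordinatewise[of _ fst] continuous_on_fst)
  have "{x. snd x \<in> Kn k (map (fst x) [0..<n])} = (\<Inter>l\<in>{..<k}. {x. - \<rho> \<le> snd x \<bullet> v l})
      \<inter> (\<Inter>m\<in>{..<n}. \<Inter>l\<in>{..<k}. {x. - \<rho> \<le> (snd x - fst x m) \<bullet> v l})"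
    unfolding Kn_map_upt_iff by auto
  then show ?thesis by (simp only:) (intro closed_Int closed_INT ballI 1 2)
qed

text \<open>A projection along a compact factor is a closed map: the closed graph is projected along
  the unit disc, which contains all polygons.\<close>

lemma closed_Kn_meets_halfplane: "closed {\<omega>. \<exists>y\<in>Kn k (map \<omega> [0..<n]). a \<le> y \<bullet> w}"
proof -
  let ?C = "cball (0::pt) 1"
  let ?U = "{x. snd x \<in> Kn k (map (fst x) [0..<n]) \<and> a \<le> snd x \<bullet> w}"
  have "closed ?U"
    by (intro closed_Collect_conj closed_graph_Kn closed_Collect_le continuous_intros)
  moreover have "?U \<subseteq> UNIV \<times> ?C"
    using Kn_subset_cball by (force simp: subset_iff)
  ultimately have 1: "closedin (prod_topology euclidean (top_of_set ?C)) ?U"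
    by (simp add: prod_topology_subtopology closedin_closed_eq closed_closedin[symmetric] closedin_subtopology) auto
  have 2: "closed_map (prod_topology (euclidean :: (nat \<Rightarrow> pt) topology) (top_of_set ?C)) euclidean fst"
    by (rule Abstract_Topological_Spaces.closed_map_fst) (simp add: compact_space_subtopology compactin_euclidean_iff)
  from 2[unfolded closed_map_def, rule_format, OF 1] have "closed (fst ` ?U)"
    by (simp only: closed_closedin)
  moreover have "fst ` ?U = {\<omega>. \<exists>y\<in>Kn k (map \<omega> [0..<n]). a \<le> y \<bullet> w}"
  proof (intro set_eqI iffI)
    fix \<omega> assume "\<omega> \<in> {\<omega>. \<exists>y\<in>Kn k (map \<omega> [0..<n]). a \<le> y \<bullet> w}"
    then obtain y where "y \<in> Kn k (map \<omega> [0..<n])" "a \<le> y \<bullet> w" by blast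
    then show "\<omega> \<in> fst ` ?U" by (intro image_eqI[of _ _ "(\<omega>, y)"]) simp_all
  qed (elim imageE, simp, blast)
  ultimately show ?thesis by (simp only:)
qed

lemma measurable_SUP_Kn:
  "(\<lambda>\<omega>. SUP y\<in>Kn k (map \<omega> [0..<n]). y \<bullet> w) \<in> borel_measurable (PiM UNIV (\<lambda>_::nat. borel))"
  unfolding borel_measurable_iff_ge
proof
  fix a :: real
  let ?M = "PiM UNIV (\<lambda>_::nat. borel :: pt measure)"
  let ?L = "\<lambda>\<omega>. Kn k (map \<omega> [0..<n])"
  have sets: "A \<in> sets ?M" if "closed A" for A
    using that by (simp add: sets_PiM_equal_borel)
  have "a \<le> (SUP y\<in>?L \<omega>. y \<bullet> w) \<longleftrightarrow> (\<exists>y\<in>?L \<omega>. a \<le> y \<bullet> w)" if ne: "?L \<omega> \<noteq> {}" for \<omega>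
  proof -
    obtain q where q: "q \<in> ?L \<omega>" "\<forall>y\<in>?L \<omega>. y \<bullet> w \<le> q \<bullet> w"
      using continuous_attains_sup[OF compact_Kn ne continuous_inner_on] by blast
    then have "(SUP y\<in>?L \<omega>. y \<bullet> w) = q \<bullet> w" by (intro cSup_eq_maximum) auto
    then show ?thesis using q by fastforce
  qed
  \<comment> \<open>On an empty polygon the supremum is the constant \<open>Sup {}\<close>.
    Non-emptiness is written as meeting the trivial halfplane \<open>-1 \<le> y \<bullet> 0\<close>,
    so that the closedness lemma covers this event too.\<close>
  then have eq: "{\<omega> \<in> space ?M. a \<le> (SUP y\<in>?L \<omega>. y \<bullet> w)}
      = {\<omega>. \<exists>y\<in>?L \<omega>. a \<le> y \<bullet> w} \<union> (if a \<le> Sup {} then - {\<omega>. \<exists>y\<in>?L \<omega>. -1 \<le> y \<bullet> 0} else {})"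
  proof (intro set_eqI)
    fix \<omega>
    assume *: "\<And>\<omega>. ?L \<omega> \<noteq> {} \<Longrightarrow> a \<le> (SUP y\<in>?L \<omega>. y \<bullet> w) \<longleftrightarrow> (\<exists>y\<in>?L \<omega>. a \<le> y \<bullet> w)"
    show "\<omega> \<in> {\<omega> \<in> space ?M. a \<le> (SUP y\<in>?L \<omega>. y \<bullet> w)} \<longleftrightarrow>
      \<omega> \<in> {\<omega>. \<exists>y\<in>?L \<omega>. a \<le> y \<bullet> w} \<union> (if a \<le> Sup {} then - {\<omega>. \<exists>y\<in>?L \<omega>. -1 \<le> y \<bullet> 0} else {})"
    proof (cases "?L \<omega> = {}")
      case True
      then show ?thesis by (simp add: space_PiM)
    next
      case False
      then have "\<exists>y. y \<in> ?L \<omega>" by blast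
      with *[OF False] show ?thesis by (simp add: space_PiM)
    qed
  qed
  show "{\<omega> \<in> space ?M. a \<le> (SUP y\<in>?L \<omega>. y \<bullet> w)} \<in> sets ?M"
  proof -
    have A: "{\<omega>. \<exists>y\<in>?L \<omega>. a \<le> y \<bullet> w} \<in> sets ?M"
      by (intro sets closed_Kn_meets_halfplane)
    have B: "- {\<omega>. \<exists>y\<in>?L \<omega>. -1 \<le> y \<bullet> 0} \<in> sets ?M"
      by (simp only: sets_PiM_equal_borel) (intro borel_comp borel_closed closed_Kn_meets_halfplane)
    then have "(if a \<le> Sup {} then - {\<omega>. \<exists>y\<in>?L \<omega>. -1 \<le> y \<bullet> 0} else {}) \<in> sets ?M"
      by (cases "a \<le> Sup {}") (simp_all only: if_True if_False sets.empty_sets)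
    then show ?thesis unfolding eq by (rule sets.Un[OF A])
  qed
qed

lemma list_measurable_height: "list_measurable (\<lambda>ps. height k ps i)"
proof -
  \<comment> \<open>Valid for empty sets as well, since \<open>Inf\<close> on the reals is defined
    through \<open>Sup\<close>.\<close>
  have eq: "(INF y\<in>A. y \<bullet> v i) = - (SUP y\<in>A. y \<bullet> (- v i))" for A :: "pt set"
    by (simp add: Inf_real_def image_image)
  show ?thesis
    unfolding list_measurable_def height_def eq
    by (intro allI borel_measurable_diff borel_measurable_uminus measurable_SUP_Kn)
qed

text \<open>The domain of integration varies with the list. Its indicator is moved into a jointly
  measurable integrand, and the area is treated as the integral of the same indicator.\<close>

lemma list_measurable_step:
  assumes F: "list_measurable F"
  shows "list_measurable (\<lambda>ps. (LINT p : Kn k ps | lborel. F (ps @ [p])) / measure lborel (Kn k ps))"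
  unfolding list_measurable_def
proof
  fix n
  let ?M = "PiM UNIV (\<lambda>_::nat. borel :: pt measure)"
  let ?L = "\<lambda>\<omega>. Kn k (map \<omega> [0..<n])"
  have "Measurable.pred (?M \<Otimes>\<^sub>M lborel) (\<lambda>x. snd x \<in> ?L (fst x))"
  proof -
    have snd: "(\<lambda>x. snd x) \<in> ?M \<Otimes>\<^sub>M lborel \<rightarrow>\<^sub>M borel"
      using measurable_snd[of ?M lborel] by simp
    have fst: "(\<lambda>x. fst x m) \<in> ?M \<Otimes>\<^sub>M lborel \<rightarrow>\<^sub>M borel" for m
      by (rule measurable_compose[OF measurable_fst measurable_component_singleton]) simp
    have 1: "Measurable.pred (?M \<Otimes>\<^sub>M lborel) (\<lambda>x. - \<rho> \<le> snd x \<bullet> v l)" for l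
      unfolding pred_def by (intro borel_measurable_le borel_measurable_inner borel_measurable_const snd)
    have 2: "Measurable.pred (?M \<Otimes>\<^sub>M lborel) (\<lambda>x. - \<rho> \<le> (snd x - fst x m) \<bullet> v l)" for l m
      unfolding pred_def
      by (intro borel_measurable_le borel_measurable_inner borel_measurable_diff borel_measurable_const snd fst)
    have 3: "Measurable.pred (?M \<Otimes>\<^sub>M lborel) (\<lambda>x. \<forall>l\<in>{..<k}. - \<rho> \<le> snd x \<bullet> v l)"
      by (rule pred_intros_finite(3)[OF finite_lessThan 1])
    have 4: "Measurable.pred (?M \<Otimes>\<^sub>M lborel) (\<lambda>x. \<forall>m\<in>{..<n}. \<forall>l\<in>{..<k}. - \<rho> \<le> (snd x - fst x m) \<bullet> v l)"
      by (rule pred_intros_finite(3)[OF finite_lessThan pred_intros_finite(3)[OF finite_lessThan 2]])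
    have "(snd x \<in> ?L (fst x)) \<longleftrightarrow> (\<forall>l\<in>{..<k}. - \<rho> \<le> snd x \<bullet> v l) \<and>
        (\<forall>m\<in>{..<n}. \<forall>l\<in>{..<k}. - \<rho> \<le> (snd x - fst x m) \<bullet> v l)" for x
      unfolding Kn_map_upt_iff by auto
    then show ?thesis
      using 3 4 unfolding pred_def by (simp only: sets.sets_Collect_conj)
  qed
  then have [measurable]: "(\<lambda>x. indicator (?L (fst x)) (snd x) :: real) \<in> borel_measurable (?M \<Otimes>\<^sub>M lborel)"
    unfolding indicator_def of_bool_def pred_def
    by (rule measurable_If[OF borel_measurable_const borel_measurable_const])
  have [measurable]: "(\<lambda>x. F (map (fst x) [0..<n] @ [snd x])) \<in> borel_measurable (?M \<Otimes>\<^sub>M lborel)"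
    using list_measurable_snoc_pair[OF F, of n] by (simp add: case_prod_beta')
  have "(\<lambda>\<omega>. LINT p : ?L \<omega> | lborel. F (map \<omega> [0..<n] @ [p])) \<in> borel_measurable ?M"
    unfolding set_lebesgue_integral_def
    by (rule lborel.borel_measurable_lebesgue_integral) (simp add: case_prod_beta', measurable)
  moreover have "(\<lambda>\<omega>. measure lborel (?L \<omega>)) \<in> borel_measurable ?M"
  proof -
    have "measure lborel (?L \<omega>) = (\<integral>p. indicator (?L \<omega>) p \<partial>lborel)" for \<omega>
      by simp
    then show ?thesis
      by (simp only:) (rule lborel.borel_measurable_lebesgue_integral, simp add: case_prod_beta')
  qed
  ultimately show "(\<lambda>\<omega>. (LINT p : ?L \<omega> | lborel. F (map \<omega> [0..<n] @ [p])) / measure lborel (?L \<omega>)) \<in> borel_measurable ?M"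
    by (rule borel_measurable_divide)
qed

lemma list_measurable_proc_expect: "list_measurable g \<Longrightarrow> list_measurable (proc_expect k n g)"
proof (induction n)
  case 0
  then show ?case by (simp add: list_measurable_def)
next
  case (Suc n)
  have "proc_expect k (Suc n) g = (\<lambda>ps. (LINT p : Kn k ps | lborel. proc_expect k n g (ps @ [p])) / measure lborel (Kn k ps))"
    by (rule ext) simp
  then show ?case
    using list_measurable_step[OF Suc.IH[OF Suc.prems]] by (simp only:)
qed

section \<open>Iterating the one-step bounds\<close>

definition avg :: "pt list \<Rightarrow> (pt \<Rightarrow> real) \<Rightarrow> real" where
  "avg ps f = (LINT p : Kn k ps | lborel. f p) / measure lborel (Kn k ps)"

lemma proc_expect_Suc: "proc_expect k (Suc n) g ps = avg ps (\<lambda>p. proc_expect k n g (ps @ [p]))"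
  by (simp add: avg_def)

lemma area_pos: "reachable ps \<Longrightarrow> 0 < measure lborel (Kn k ps)"
  by (rule area_lower_bound) (metis less_le_trans)

lemma set_integrable_Kn:
  fixes f :: "pt \<Rightarrow> real"
  assumes "f \<in> borel_measurable lborel" "\<And>p. p \<in> Kn k ps \<Longrightarrow> \<bar>f p\<bar> \<le> B"
  shows "set_integrable lborel (Kn k ps) f"
  unfolding set_integrable_def
  using fmeasurable_Kn[of ps] assms
  by (intro integrableI_bounded_set_indicator[where B = B]) (auto simp: fmeasurable_def)

lemma avg_mono:
  assumes "reachable ps" "f \<in> borel_measurable lborel" "g \<in> borel_measurable lborel"
    "\<And>p. p \<in> Kn k ps \<Longrightarrow> \<bar>f p\<bar> \<le> B" "\<And>p. p \<in> Kn k ps \<Longrightarrow> \<bar>g p\<bar> \<le> B"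
    "\<And>p. p \<in> Kn k ps \<Longrightarrow> f p \<le> g p"
  shows "avg ps f \<le> avg ps g"
  unfolding avg_def
  by (intro divide_right_mono set_integral_mono set_integrable_Kn[where B = B] assms measure_nonneg)

lemma avg_cmult: "avg ps (\<lambda>p. c * f p) = c * avg ps f"
  by (simp add: avg_def)

lemma avg_indicator:
  assumes "reachable ps" "S \<in> sets lborel" "S \<subseteq> Kn k ps"
  shows "avg ps (\<lambda>p. a + b * indicator S p) = a + b * (measure lborel S / measure lborel (Kn k ps))"
proof -
  have fin: "Kn k ps \<in> sets lborel" "emeasure lborel (Kn k ps) < \<infinity>"
    using fmeasurable_Kn[of ps] by (auto simp: fmeasurable_def)
  have "set_integrable lborel (Kn k ps) (\<lambda>_. a)"
    by (rule set_integrable_Kn[where B = "\<bar>a\<bar>"]) auto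
  moreover have "set_integrable lborel (Kn k ps) (\<lambda>p. b * indicator S p)"
    using assms(2) by (intro set_integrable_Kn[where B = "\<bar>b\<bar>"]) (auto simp: indicator_def abs_mult)
  ultimately have "(LINT p : Kn k ps | lborel. a + b * indicator S p)
      = (LINT p : Kn k ps | lborel. a) + (LINT p : Kn k ps | lborel. b * indicator S p)"
    by (rule set_integral_add(2))
  also have "(LINT p : Kn k ps | lborel. a) = a * measure lborel (Kn k ps)"
    using fin by (subst set_integral_const) (auto simp: top.not_eq_extremum)
  also have "(LINT p : Kn k ps | lborel. b * indicator S p) = b * measure lborel S"
  proof -
    have "(LINT p : Kn k ps | lborel. indicator S p) = (\<integral>p. indicator S p \<partial>lborel :: real)"
      unfolding set_lebesgue_integral_def
      using assms(3) by (intro Bochner_Integration.integral_cong) (auto simp: indicator_def)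
    then show ?thesis by simp
  qed
  finally show ?thesis
    unfolding avg_def using area_pos[OF assms(1)] by (simp add: add_divide_distrib)
qed

lemma avg_const: "reachable ps \<Longrightarrow> avg ps (\<lambda>_. a) = a"
  using avg_indicator[of ps "{}" a 0] by simp

text \<open>Conditioning on one step: \<open>a\<close> is guaranteed everywhere, \<open>b\<close> on
  the favourable set \<open>S\<close>. \<open>survival_bound\<close> takes \<open>a\<close> = 0,
  \<open>lower_one_height\<close> takes \<open>b\<close> = 1.\<close>

lemma avg_ge:
  assumes "reachable ps" "f \<in> borel_measurable lborel" "S \<in> sets lborel" "S \<subseteq> Kn k ps"
    and bounds: "\<And>p. p \<in> Kn k ps \<Longrightarrow> a \<le> f p" "\<And>p. p \<in> Kn k ps \<Longrightarrow> f p \<le> B"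
    and S: "\<And>p. p \<in> S \<Longrightarrow> b \<le> f p"
  shows "a + (b - a) * (measure lborel S / measure lborel (Kn k ps)) \<le> avg ps f"
proof -
  have "avg ps (\<lambda>p. a + (b - a) * indicator S p) \<le> avg ps f"
  proof (rule avg_mono[where B = "\<bar>a\<bar> + \<bar>b\<bar> + \<bar>B\<bar>"])
    fix p assume p: "p \<in> Kn k ps"
    show "\<bar>a + (b - a) * indicator S p\<bar> \<le> \<bar>a\<bar> + \<bar>b\<bar> + \<bar>B\<bar>"
      by (cases "p \<in> S") auto
    show "\<bar>f p\<bar> \<le> \<bar>a\<bar> + \<bar>b\<bar> + \<bar>B\<bar>" using bounds[OF p] by linarith
    show "a + (b - a) * indicator S p \<le> f p"
      using bounds[OF p] S by (cases "p \<in> S") auto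
  qed (use assms in auto)
  then show ?thesis using avg_indicator[OF assms(1,3,4)] by simp
qed

definition unit_observable :: "(pt list \<Rightarrow> real) \<Rightarrow> bool" where
  "unit_observable F \<longleftrightarrow> list_measurable F \<and> (\<forall>ps. reachable ps \<longrightarrow> 0 \<le> F ps \<and> F ps \<le> 1)"

lemma unit_observableD:
  assumes "unit_observable F"
  shows "list_measurable F" "reachable ps \<Longrightarrow> 0 \<le> F ps" "reachable ps \<Longrightarrow> F ps \<le> 1"
    "(\<lambda>p. F (ps @ [p])) \<in> borel_measurable lborel"
  using assms list_measurable_snoc by (auto simp: unit_observable_def)

lemma unit_observable_proc_expect:
  assumes "unit_observable F"
  shows "unit_observable (proc_expect k n F)"
proof (induction n)
  case 0
  then show ?case using assms by (simp add: unit_observable_def list_measurable_def)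
next
  case (Suc n)
  note F = unit_observableD[OF Suc.IH]
  have "0 \<le> avg ps (\<lambda>p. proc_expect k n F (ps @ [p])) \<and> avg ps (\<lambda>p. proc_expect k n F (ps @ [p])) \<le> 1"
    if ps: "reachable ps" for ps
  proof -
    have r: "reachable (ps @ [p])" if "p \<in> Kn k ps" for p using ps that by simp
    have "avg ps (\<lambda>_. 0) \<le> avg ps (\<lambda>p. proc_expect k n F (ps @ [p]))"
      using F(2,3)[OF r] by (intro avg_mono[OF ps _ F(4), where B = 1]) auto
    moreover have "avg ps (\<lambda>p. proc_expect k n F (ps @ [p])) \<le> avg ps (\<lambda>_. 1)"
      using F(2,3)[OF r] by (intro avg_mono[OF ps F(4), where B = 1]) auto
    ultimately show ?thesis using avg_const[OF ps] by simp
  qed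
  then show ?case
    using list_measurable_proc_expect[of F "Suc n"] unit_observableD(1)[OF assms]
    unfolding unit_observable_def proc_expect_Suc by blast
qed

text \<open>For chaining phases: \<open>F\<close> will itself be the expectation over a further
  phase, and \<open>c\<close> a lower bound for the success probability of that phase once
  \<open>G\<close> holds.\<close>

lemma proc_expect_scaled_mono:
  assumes F: "unit_observable F" and G: "unit_observable G" and c: "0 \<le> c" "c \<le> 1"
    and le: "\<And>ps. reachable ps \<Longrightarrow> c * G ps \<le> F ps"
  shows "reachable ps \<Longrightarrow> c * proc_expect k n G ps \<le> proc_expect k n F ps"
proof (induction n arbitrary: ps)
  case 0
  then show ?case using le by simp
next
  case (Suc n)
  note Fn = unit_observableD[OF unit_observable_proc_expect[OF F, of n]]
  note Gn = unit_observableD[OF unit_observable_proc_expect[OF G, of n]]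
  have r: "reachable (ps @ [p])" if "p \<in> Kn k ps" for p using Suc.prems that by simp
  have "avg ps (\<lambda>p. c * proc_expect k n G (ps @ [p])) \<le> avg ps (\<lambda>p. proc_expect k n F (ps @ [p]))"
  proof (rule avg_mono[OF Suc.prems _ Fn(4), where B = 1])
    fix p assume "p \<in> Kn k ps"
    note rp = r[OF this]
    show "\<bar>c * proc_expect k n G (ps @ [p])\<bar> \<le> 1"
      using Gn(2,3)[OF rp] c by (simp add: abs_mult mult_le_one)
    show "\<bar>proc_expect k n F (ps @ [p])\<bar> \<le> 1" using Fn(2,3)[OF rp] by simp
    show "c * proc_expect k n G (ps @ [p]) \<le> proc_expect k n F (ps @ [p])" using Suc.IH[OF rp] .
  qed (use Gn(4) in simp)
  then show ?case unfolding proc_expect_Suc avg_cmult .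
qed

text \<open>The tower property: the list of all points drawn is the state.\<close>

lemma proc_expect_add: "proc_expect k (m + n) g ps = proc_expect k m (proc_expect k n g) ps"
  by (induction m arbitrary: ps) simp_all

text \<open>Reachability keeps the average normalised; over a polygon of area 0 division by zero
  would make both averages 0.\<close>

lemma proc_expect_compl:
  assumes F: "unit_observable F"
  shows "reachable ps \<Longrightarrow> proc_expect k n (\<lambda>ps. 1 - F ps) ps = 1 - proc_expect k n F ps"
proof (induction n arbitrary: ps)
  case 0
  then show ?case by simp
next
  case (Suc n)
  note Fn = unit_observableD[OF unit_observable_proc_expect[OF F, of n]]
  have r: "reachable (ps @ [p])" if "p \<in> Kn k ps" for p using Suc.prems that by simp
  have int: "set_integrable lborel (Kn k ps) (\<lambda>p. proc_expect k n F (ps @ [p]))"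
    using Fn(2,3)[OF r] by (intro set_integrable_Kn[where B = 1] Fn(4)) auto
  have "(LINT p : Kn k ps | lborel. proc_expect k n (\<lambda>ps. 1 - F ps) (ps @ [p]))
      = (LINT p : Kn k ps | lborel. 1 - proc_expect k n F (ps @ [p]))"
    using Suc.IH[OF r] fmeasurable_Kn[of ps]
    by (intro set_lebesgue_integral_cong) (auto simp: fmeasurable_def)
  also have "\<dots> = (LINT p : Kn k ps | lborel. 1) - (LINT p : Kn k ps | lborel. proc_expect k n F (ps @ [p]))"
    by (intro set_integral_diff int set_integrable_Kn[where B = 1]) auto
  finally have "avg ps (\<lambda>p. proc_expect k n (\<lambda>ps. 1 - F ps) (ps @ [p]))
      = avg ps (\<lambda>_. 1) - avg ps (\<lambda>p. proc_expect k n F (ps @ [p]))"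
    unfolding avg_def by (simp add: diff_divide_distrib)
  then show ?case unfolding proc_expect_Suc avg_const[OF Suc.prems] .
qed

lemma unit_observable_compl:
  assumes "unit_observable F"
  shows "unit_observable (\<lambda>ps. 1 - F ps)"
  using assms unfolding unit_observable_def list_measurable_def
  by (auto intro!: borel_measurable_diff)

text \<open>The parameter \<open>m\<close> counts the directions already treated:
  \<open>m = 0\<close> is the sure event, and \<open>m = k\<close> bounds
  \<open>maxheight\<close>.\<close>

definition heights_below :: "nat \<Rightarrow> real \<Rightarrow> pt list \<Rightarrow> real" where
  "heights_below m s ps = of_bool (\<forall>i<m. height k ps i \<le> \<rho> + s)"

lemma unit_observable_heights_below: "unit_observable (heights_below m s)"
  unfolding unit_observable_def heights_below_def
  using list_measurable_indicator_le[of m "\<lambda>i ps. height k ps i" "\<rho> + s"] list_measurable_height by simp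

lemma sets_height_le: "{p \<in> Kn k ps. height k (ps @ [p]) i \<le> c} \<in> sets lborel"
proof -
  have "{p \<in> space lborel. height k (ps @ [p]) i \<le> c} \<in> sets lborel"
    by (intro borel_measurable_le list_measurable_snoc list_measurable_height borel_measurable_const)
  moreover have "Kn k ps \<in> sets lborel" using fmeasurable_Kn by (simp add: fmeasurable_def)
  ultimately have "Kn k ps \<inter> {p \<in> space lborel. height k (ps @ [p]) i \<le> c} \<in> sets lborel" by (intro sets.Int)
  then show ?thesis by (simp add: Collect_conj_eq)
qed

lemma sets_maxheight_le: "{p \<in> Kn k ps. maxheight k (ps @ [p]) \<le> c} \<in> sets lborel"
proof -
  have "{p \<in> Kn k ps. maxheight k (ps @ [p]) \<le> c} = (\<Inter>i\<in>{..<k}. {p \<in> Kn k ps. height k (ps @ [p]) i \<le> c})"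
    using k_pos by (auto simp: maxheight_le_iff)
  then show ?thesis
    using k_pos by (simp only:) (intro sets.finite_INT sets_height_le, auto)
qed

lemma survival_bound:
  obtains C where "C > 0"
    "\<And>s n. s > 0 \<Longrightarrow> s < 1 \<Longrightarrow> C * s\<^sup>2 \<le> 1 \<Longrightarrow>
      (1 - C * s\<^sup>2) ^ n \<le> proc_expect k n (\<lambda>ps. 1 - heights_below k s ps) []"
proof -
  obtain C where C: "C > 0"
    "\<And>ps s. \<lbrakk>reachable ps; s > 0; maxheight k ps > \<rho> + s; {p \<in> Kn k ps. maxheight k (ps @ [p]) \<le> \<rho> + s} \<in> sets lborel\<rbrakk> \<Longrightarrow>
      measure lborel {p \<in> Kn k ps. maxheight k (ps @ [p]) \<le> \<rho> + s} \<le> C * s\<^sup>2 * measure lborel (Kn k ps)"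
    using overshoot_area by blast
  have main: "(1 - C * s\<^sup>2) ^ n \<le> proc_expect k n (\<lambda>ps. 1 - heights_below k s ps) ps"
    if s: "s > 0" "C * s\<^sup>2 \<le> 1" and "reachable ps" "maxheight k ps > \<rho> + s" for s n ps
    using that(3,4)
  proof (induction n arbitrary: ps)
    case 0
    then show ?case using maxheight_le_iff[of ps "\<rho> + s"] by (auto simp: heights_below_def)
  next
    case (Suc n)
    note ps = Suc.prems(1)
    let ?F = "proc_expect k n (\<lambda>ps. 1 - heights_below k s ps)"
    note F = unit_observableD[OF unit_observable_proc_expect[OF
      unit_observable_compl[OF unit_observable_heights_below], of n]]
    let ?bad = "{p \<in> Kn k ps. maxheight k (ps @ [p]) \<le> \<rho> + s}"
    define S where "S = Kn k ps - ?bad"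
    have r: "reachable (ps @ [p])" if "p \<in> Kn k ps" for p using ps that by simp
    have K: "Kn k ps \<in> sets lborel" using fmeasurable_Kn by (simp add: fmeasurable_def)
    have S: "S \<in> sets lborel" "S \<subseteq> Kn k ps"
      unfolding S_def using sets_maxheight_le K by (auto intro: sets.Diff)
    have "measure lborel S = measure lborel (Kn k ps) - measure lborel ?bad"
      unfolding S_def using fmeasurable_Kn sets_maxheight_le
      by (intro measurable_measure_Diff) (auto simp: fmeasurable_def)
    also have "\<dots> \<ge> (1 - C * s\<^sup>2) * measure lborel (Kn k ps)"
      using C(2)[OF ps s(1) Suc.prems(2) sets_maxheight_le] by (simp add: left_diff_distrib)
    finally have ratio: "1 - C * s\<^sup>2 \<le> measure lborel S / measure lborel (Kn k ps)"
      using area_pos[OF ps] by (simp add: pos_le_divide_eq)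
    have "(1 - C * s\<^sup>2) ^ Suc n \<le> (1 - C * s\<^sup>2) ^ n * (measure lborel S / measure lborel (Kn k ps))"
      unfolding power_Suc2 using ratio s(2) by (intro mult_left_mono) simp_all
    \<comment> \<open>Written in the form of \<open>avg_ge\<close>: nothing is claimed off
      \<open>S\<close>.\<close>
    also have "\<dots> = 0 + ((1 - C * s\<^sup>2) ^ n - 0) * (measure lborel S / measure lborel (Kn k ps))"
      by simp
    also have "\<dots> \<le> avg ps (\<lambda>p. ?F (ps @ [p]))"
    proof (rule avg_ge[OF ps F(4) S, where B = 1])
      fix p assume "p \<in> S"
      then show "(1 - C * s\<^sup>2) ^ n \<le> ?F (ps @ [p])"
        unfolding S_def using ps by (intro Suc.IH) auto
    qed (use F(2,3)[OF r] in auto)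
    finally show ?case unfolding proc_expect_Suc .
  qed
  \<comment> \<open>The bound \<open>s < 1\<close> places the initial polygon, of largest height at
    least \<open>1 + \<rho>\<close>, above the threshold.\<close>
  have "(1 - C * s\<^sup>2) ^ n \<le> proc_expect k n (\<lambda>ps. 1 - heights_below k s ps) []"
    if "s > 0" "s < 1" "C * s\<^sup>2 \<le> 1" for s n
    using maxheight_Nil that by (intro main) auto
  then show ?thesis using C(1) that by blast
qed

section \<open>Bringing all heights down, one direction after another\<close>

lemma mem_Kn_snoc: "p \<in> Kn k ps \<Longrightarrow> p \<in> Kn k (ps @ [p])"
  using rho_pos by (simp add: Kn_snoc)

lemma heights_below_snoc:
  assumes "heights_below m s ps = 1" "p \<in> Kn k ps"
  shows "heights_below m s (ps @ [p]) = 1"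
proof -
  have "height k (ps @ [p]) i \<le> height k ps i" for i
    using mem_Kn_snoc[OF assms(2)] by (intro height_antimono) (auto simp only: Kn_snoc)
  then show ?thesis
    using assms(1) order_trans unfolding heights_below_def of_bool_eq_1_iff by blast
qed

lemma heights_below_persists:
  "reachable ps \<Longrightarrow> heights_below m s ps = 1 \<Longrightarrow> 1 \<le> proc_expect k n (heights_below m s) ps"
proof (induction n arbitrary: ps)
  case (Suc n)
  note F = unit_observableD[OF unit_observable_proc_expect[OF unit_observable_heights_below[of m s], of n]]
  \<comment> \<open>\<open>avg_ge\<close> with empty favourable set: the lower bound 1 holds
    everywhere.\<close>
  have "1 + (1 - 1) * (measure lborel ({} :: pt set) / measure lborel (Kn k ps))
      \<le> avg ps (\<lambda>p. proc_expect k n (heights_below m s) (ps @ [p]))"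
  proof (rule avg_ge[OF Suc.prems(1) F(4), where B = 1])
    fix p assume "p \<in> Kn k ps"
    then show "1 \<le> proc_expect k n (heights_below m s) (ps @ [p])"
      using Suc.prems by (intro Suc.IH heights_below_snoc) simp_all
  qed (use Suc.prems(1) F(3) in simp_all)
  then show ?case unfolding proc_expect_Suc by simp
qed simp

lemma lower_one_height:
  assumes s: "0 < s" "s \<le> 2" and m: "m < k" and "reachable ps" "heights_below m s ps = 1"
  shows "1 - (1 - s\<^sup>2 / 4) ^ n \<le> proc_expect k n (heights_below (Suc m) s) ps"
proof -
  have F: "unit_observable (proc_expect k n (heights_below (Suc m) s))" for n
    by (intro unit_observable_proc_expect unit_observable_heights_below)
  define \<beta> where "\<beta> = s\<^sup>2 / 4"
  have \<beta>: "0 \<le> \<beta>" "\<beta> \<le> 1"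
    using s power_mono[of s 2 2] by (auto simp: \<beta>_def)
  have "1 - (1 - \<beta>) ^ n \<le> proc_expect k n (heights_below (Suc m) s) ps"
    if "reachable ps" "heights_below m s ps = 1" for ps
    using that
  proof (induction n arbitrary: ps)
    case 0
    then show ?case by (simp add: heights_below_def)
  next
    case (Suc n)
    note ps = Suc.prems(1)
    let ?S = "{p \<in> Kn k ps. height k (ps @ [p]) m \<le> \<rho> + s}"
    let ?F = "proc_expect k n (heights_below (Suc m) s)"
    have r: "reachable (ps @ [p])" if "p \<in> Kn k ps" for p using ps that by simp
    have "\<beta> * measure lborel (Kn k ps) \<le> measure lborel ?S"
      unfolding \<beta>_def by (rule shrink_area[OF ps s sets_height_le m])
    then have ratio: "\<beta> \<le> measure lborel ?S / measure lborel (Kn k ps)"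
      using area_pos[OF ps] by (simp add: pos_le_divide_eq)
    \<comment> \<open>A success in the first step is permanent; after a failure the remaining
      \<open>n\<close> steps still apply, because the first \<open>m\<close> heights stay
      low.\<close>
    have "1 - (1 - \<beta>) ^ Suc n = (1 - (1 - \<beta>) ^ n) + (1 - \<beta>) ^ n * \<beta>"
      by (simp add: algebra_simps)
    also have "\<dots> \<le> (1 - (1 - \<beta>) ^ n) + (1 - \<beta>) ^ n * (measure lborel ?S / measure lborel (Kn k ps))"
      using ratio \<beta> by (intro add_left_mono mult_left_mono) auto
    also have "\<dots> = (1 - (1 - \<beta>) ^ n) + (1 - (1 - (1 - \<beta>) ^ n)) * (measure lborel ?S / measure lborel (Kn k ps))"
      by simp
    also have "\<dots> \<le> avg ps (\<lambda>p. ?F (ps @ [p]))"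
    proof (rule avg_ge[OF ps unit_observableD(4)[OF F] sets_height_le, where B = 1])
      fix p assume p: "p \<in> Kn k ps"
      show "1 - (1 - \<beta>) ^ n \<le> ?F (ps @ [p])"
        using Suc.IH[OF r[OF p] heights_below_snoc[OF Suc.prems(2) p]] .
      show "?F (ps @ [p]) \<le> 1" by (rule unit_observableD(3)[OF F r[OF p]])
    next
      fix p assume p: "p \<in> ?S"
      then have "heights_below (Suc m) s (ps @ [p]) = 1"
        using heights_below_snoc[OF Suc.prems(2)] by (auto simp: heights_below_def less_Suc_eq)
      then show "1 \<le> ?F (ps @ [p])" using p ps by (intro heights_below_persists) simp_all
    qed auto
    finally show ?case unfolding proc_expect_Suc .
  qed
  then show ?thesis using assms(4,5) by (simp add: \<beta>_def)
qed

text \<open>The last \<open>N\<close> steps serve direction \<open>m\<close>, the earlier ones the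
  previous directions. Allowing \<open>m * N \<le> n\<close> absorbs the remainder: surplus steps
  are spent at the start, before any direction is treated.\<close>

lemma lower_all_heights:
  assumes s: "0 < s" "s \<le> 2"
  shows "m \<le> k \<Longrightarrow> m * N \<le> n \<Longrightarrow> reachable ps \<Longrightarrow>
    (1 - (1 - s\<^sup>2 / 4) ^ N) ^ m \<le> proc_expect k n (heights_below m s) ps"
proof (induction m arbitrary: n)
  case 0
  then show ?case
    using heights_below_persists[of ps 0 s n] by (simp add: heights_below_def[of 0 s ps])
next
  case (Suc m)
  define \<gamma> where "\<gamma> = 1 - (1 - s\<^sup>2 / 4) ^ N"
  have "s\<^sup>2 / 4 \<le> 1" using s power_mono[of s 2 2] by simp
  then have \<gamma>: "0 \<le> \<gamma>" "\<gamma> \<le> 1" by (auto simp: \<gamma>_def power_le_one)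
  have n: "n = (n - N) + N" "m * N \<le> n - N" using Suc.prems by auto
  have step: "\<gamma> * heights_below m s qs \<le> proc_expect k N (heights_below (Suc m) s) qs"
    if qs: "reachable qs" for qs
  proof (cases "heights_below m s qs = 1")
    case True
    then show ?thesis using lower_one_height[OF s _ qs True, of N] Suc.prems by (simp add: \<gamma>_def)
  next
    case False
    then have "heights_below m s qs = 0" by (auto simp: heights_below_def)
    then show ?thesis
      using unit_observableD(2)[OF unit_observable_proc_expect[OF unit_observable_heights_below] qs] by simp
  qed
  have "\<gamma> * \<gamma> ^ m \<le> \<gamma> * proc_expect k (n - N) (heights_below m s) ps"
    using Suc.IH[OF _ n(2)] Suc.prems \<gamma> unfolding \<gamma>_def by (intro mult_left_mono) auto
  also have "\<dots> \<le> proc_expect k (n - N) (proc_expect k N (heights_below (Suc m) s)) ps"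
    by (rule proc_expect_scaled_mono[OF _ _ \<gamma> step Suc.prems(3)])
       (intro unit_observable_proc_expect unit_observable_heights_below)+
  also have "\<dots> = proc_expect k n (heights_below (Suc m) s) ps"
    by (subst (2) n(1)) (simp only: proc_expect_add)
  finally show ?case by (simp add: \<gamma>_def)
qed

section \<open>Passage to the limit\<close>

lemma proc_prob_eq:
  assumes "n > 0"
  shows "proc_prob k n (\<lambda>ps. sqrt (real n) * (maxheight k ps - \<rho>) > x)
    = proc_expect k n (\<lambda>ps. 1 - heights_below k (x / sqrt n) ps) []"
proof -
  have "sqrt n * (maxheight k ps - \<rho>) > x \<longleftrightarrow> \<not> (\<forall>i<k. height k ps i \<le> \<rho> + x / sqrt n)" for ps
  proof -
    have "sqrt n * (maxheight k ps - \<rho>) > x \<longleftrightarrow> \<not> maxheight k ps \<le> \<rho> + x / sqrt n"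
      using assms by (simp add: field_simps not_le)
    then show ?thesis by (simp only: maxheight_le_iff)
  qed
  then have "(\<lambda>ps. if sqrt n * (maxheight k ps - \<rho>) > x then 1 else 0) = (\<lambda>ps. 1 - heights_below k (x / sqrt n) ps)"
    by (intro ext) (simp only: heights_below_def, simp)
  then show ?thesis by (simp only: proc_prob_def)
qed

lemma liminf_pos:
  assumes x: "x > 0"
  shows "0 < liminf (\<lambda>n. ereal (proc_prob k n (\<lambda>ps. sqrt (real n) * (maxheight k ps - \<rho>) > x)))"
proof -
  let ?P = "\<lambda>n. proc_prob k n (\<lambda>ps. sqrt (real n) * (maxheight k ps - \<rho>) > x)"
  obtain C where C: "C > 0" "\<And>s n. s > 0 \<Longrightarrow> s < 1 \<Longrightarrow> C * s\<^sup>2 \<le> 1 \<Longrightarrow>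
      (1 - C * s\<^sup>2) ^ n \<le> proc_expect k n (\<lambda>ps. 1 - heights_below k s ps) []"
    using survival_bound by blast
  have "(\<lambda>n. (1 + (- C * x\<^sup>2) / real n) ^ n) \<longlonglongrightarrow> exp (- C * x\<^sup>2)"
    by (rule tendsto_exp_limit_sequentially)
  then have "\<forall>\<^sub>F n in sequentially. (1 + (- C * x\<^sup>2) / real n) ^ n > exp (- C * x\<^sup>2) / 2"
    by (rule order_tendstoD) simp
  \<comment> \<open>The two thresholds give \<open>s < 1\<close> and
    \<open>C * s\<^sup>2 \<le> 1\<close>.\<close>
  moreover have "\<forall>\<^sub>F n in sequentially. real n > max (x\<^sup>2) (C * x\<^sup>2)"
    using filterlim_real_sequentially unfolding filterlim_at_top_dense by blast
  ultimately have "\<forall>\<^sub>F n in sequentially. ereal (exp (- C * x\<^sup>2) / 2) \<le> ereal (?P n)"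
  proof eventually_elim
    case (elim n)
    then have n: "real n > x\<^sup>2" "real n > C * x\<^sup>2" by auto
    then have n0: "n > 0" using x by (metis of_nat_0_less_iff order_le_less_trans zero_le_power2)
    define s where "s = x / sqrt n"
    have s2: "s\<^sup>2 = x\<^sup>2 / n" by (simp add: s_def power_divide)
    have "s > 0" using x n0 by (simp add: s_def)
    moreover have "s < 1"
      using n n0 x real_less_rsqrt[of x "real n"] by (simp add: s_def)
    moreover have "C * s\<^sup>2 \<le> 1" using n n0 by (simp add: s2 field_simps)
    ultimately have "(1 - C * s\<^sup>2) ^ n \<le> ?P n"
      using C(2) by (simp add: proc_prob_eq[OF n0] s_def)
    then show ?case using elim(1) by (simp add: s2)
  qed
  then have "ereal (exp (- C * x\<^sup>2) / 2) \<le> liminf (\<lambda>n. ereal (?P n))"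
    by (rule Liminf_bounded)
  moreover have "0 < ereal (exp (- C * x\<^sup>2) / 2)" by simp
  ultimately show ?thesis by (rule less_le_trans[rotated])
qed

lemma limsup_less_1:
  assumes x: "x > 0"
  shows "limsup (\<lambda>n. ereal (proc_prob k n (\<lambda>ps. sqrt (real n) * (maxheight k ps - \<rho>) > x))) < 1"
proof -
  let ?P = "\<lambda>n. proc_prob k n (\<lambda>ps. sqrt (real n) * (maxheight k ps - \<rho>) > x)"
  \<comment> \<open>With \<open>N = n div k\<close> at least \<open>n / (2 * k)\<close> and
    \<open>s\<^sup>2 = x\<^sup>2 / n\<close>, the exponent \<open>N * (s\<^sup>2 / 4)\<close> is at
    least \<open>x\<^sup>2 / (8 * k)\<close>.\<close>
  define \<gamma> where "\<gamma> = 1 - exp (- (x\<^sup>2 / (8 * k)))"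
  have \<gamma>: "\<gamma> > 0" using x k_pos by (simp add: \<gamma>_def)
  have "\<forall>\<^sub>F n in sequentially. real n > x\<^sup>2"
    using filterlim_real_sequentially unfolding filterlim_at_top_dense by blast
  moreover have "\<forall>\<^sub>F n in sequentially. n \<ge> k" by (rule eventually_ge_at_top)
  ultimately have "\<forall>\<^sub>F n in sequentially. ereal (?P n) \<le> ereal (1 - \<gamma> ^ k)"
  proof eventually_elim
    case (elim n)
    then have n0: "n > 0" using k_pos by linarith
    define s where "s = x / sqrt n"
    define N where "N = n div k"
    have s2: "s\<^sup>2 = x\<^sup>2 / n" by (simp add: s_def power_divide)
    have s: "0 < s" "s \<le> 2"
      using elim n0 x real_less_rsqrt[of x "real n"] by (auto simp: s_def field_simps)
    have "n < k * (N + 1)" using k_pos by (simp add: N_def dividend_less_times_div)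
    moreover have "N \<ge> 1" using elim(2) k_pos by (simp add: N_def Suc_le_eq div_greater_zero_iff)
    ultimately have "n \<le> 2 * k * N"
      by (metis (no_types, opaque_lifting) add_mono_thms_linordered_semiring(2) less_imp_le mult.assoc mult.commute mult_2 mult_le_mono2 order_trans)
    then have "real n \<le> 2 * real k * real N" by (metis of_nat_le_iff of_nat_mult of_nat_numeral)
    then have "x\<^sup>2 * real n \<le> x\<^sup>2 * (2 * real k * real N)" by (intro mult_left_mono) auto
    then have ge: "x\<^sup>2 / (8 * k) \<le> real N * (s\<^sup>2 / 4)"
      using n0 k_pos by (simp add: s2 field_simps)
    have "1 - s\<^sup>2 / 4 \<ge> 0" using s power_mono[of s 2 2] by simp
    then have "(1 - s\<^sup>2 / 4) ^ N \<le> exp (- (s\<^sup>2 / 4)) ^ N"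
      using exp_ge_add_one_self[of "- (s\<^sup>2 / 4)"] by (intro power_mono) auto
    also have "\<dots> = exp (- (real N * (s\<^sup>2 / 4)))" by (simp flip: exp_of_nat_mult)
    also have "\<dots> \<le> exp (- (x\<^sup>2 / (8 * k)))" using ge by simp
    finally have "\<gamma> ^ k \<le> (1 - (1 - s\<^sup>2 / 4) ^ N) ^ k"
      using \<gamma> by (intro power_mono) (auto simp: \<gamma>_def)
    also have "\<dots> \<le> proc_expect k n (heights_below k s) []"
      by (rule lower_all_heights[OF s]) (auto simp: N_def)
    finally have "?P n \<le> 1 - \<gamma> ^ k"
      by (simp add: proc_prob_eq[OF n0] proc_expect_compl[OF unit_observable_heights_below] s_def)
    then show ?case by simp
  qed
  then have "limsup (\<lambda>n. ereal (?P n)) \<le> ereal (1 - \<gamma> ^ k)" by (rule Limsup_bounded)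
  also have "\<dots> < 1" using \<gamma> by simp
  finally show ?thesis .
qed

end

theorem theorem8:
  fixes k :: nat and x :: real
  assumes "odd k" "k \<ge> 5" "x > 0"
  shows "0 < liminf (\<lambda>n. ereal (proc_prob k n
              (\<lambda>ps. sqrt (real n) * (maxheight k ps - rho k) > x)))
       \<and> liminf (\<lambda>n. ereal (proc_prob k n
              (\<lambda>ps. sqrt (real n) * (maxheight k ps - rho k) > x)))
         \<le> limsup (\<lambda>n. ereal (proc_prob k n
              (\<lambda>ps. sqrt (real n) * (maxheight k ps - rho k) > x)))
       \<and> limsup (\<lambda>n. ereal (proc_prob k n
              (\<lambda>ps. sqrt (real n) * (maxheight k ps - rho k) > x))) < 1"
proof -
  interpret odd_polygon k by unfold_locales (use assms in auto)
  show ?thesis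
    using liminf_pos[OF assms(3)] limsup_less_1[OF assms(3)]
    by (intro conjI Liminf_le_Limsup) auto
qed

end
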